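(* Let $M,\alpha$ be real parameters with $\alpha\ne0$, and let $g$ be the Riemannian Kerr metric with mass $M$ and imaginary angular momentum parameter $\alpha$, on the region where it is Riemannian. Then the conformal class $[g]$ admits a regular ambitoric structure, of hyperbolic type, whose Killing vector fields $\mathfrak t$ are spanned by the time translation and axial rotation fields. Explicitly, there are coordinates $(x,y,t_1,t_2)$ in which $\mathfrak t=\mathrm{span}\{\partial_{t_1},\partial_{t_2}\}$ and the ambitoric structure is given by $$g_0=\frac{dx^2}{A(x)}+\frac{dy^2}{B(y)}+\frac{A(x)(dt_1+y^2dt_2)^2}{(x^2-y^2)^2}+\frac{B(y)(dt_1+x^2dt_2)^2}{(x^2-y^2)^2},$$ $$\omega_\pm=\frac{dx\wedge(dt_1+y^2dt_2)}{(x\pm y)^2}\pm\frac{dy\wedge(dt_1+x^2dt_2)}{(x\pm y)^2},$$ with $$A(x)=x^2-2Mx-\alpha^2,\qquad B(y)=\alpha^2-y^2,$$ and the Ricci-flat metric is $g=(x^2-y^2)g_0$.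
   Context: The Riemannian Kerr metric is obtained from the Lorentzian Kerr metric by the Wick rotation in which the time and angular momentum variables take imaginary values; explicitly, with $\Delta=r^2-2Mr-\alpha^2$ and $\Sigma=r^2-\alpha^2\cos^2\theta$, $$g=\Sigma\Big(\frac{dr^2}{\Delta}+d\theta^2\Big)+\frac{\Delta}{\Sigma}(dt+\alpha\sin^2\theta\,d\varphi)^2+\frac{\sin^2\theta}{\Sigma}\big((r^2-\alpha^2)d\varphi-\alpha\,dt\big)^2,$$ considered on the region $\Delta>0$, $\Sigma>0$, $0<\theta<\pi$. The time translation and axial rotation fields are $\partial_t,\partial_\varphi$; $(t,\varphi)$ are taken modulo a lattice, so that they generate a 2-torus action. An ambitoric structure on a 4-manifold consists of a conformal class $[g]$, two compatible complex structures $J_\pm$ inducing opposite orientations, metrics $g_\pm\in[g]$ Kähler with respect to $J_\pm$, with Kähler forms $\omega_\pm=g_\pm(J_\pm\cdot,\cdot)$, and a 2-torus (Lie algebra $\mathfrak t$) acting by isometries Hamiltonian for both $\omega_\pm$. Writing $g_-=f^2g_+$ with $f>0$, the barycentric metric is $g_0=fg_+=f^{-1}g_-$; here $f=\frac{x+y}{x-y}$. On the open dense set where $\mathfrak t$ spans a rank 2 distribution, it meets the $\pm1$-eigenbundles of $-J_+J_-$ in line bundles, defining maps $\xi,\eta$ to $\mathbb P(\mathfrak t)$; the structure is regular if $d\xi\wedge d\eta$ is non-vanishing on an open dense set. Hyperbolic type refers to the displayed local form of $g_0,\omega_\pm$ (for functions $A(x)$, $B(y)$ of one variable). *)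

theory Defs
  imports "HOL-Analysis.Analysis"
begin

text \<open>
  The 4-manifolds are quotients of an open set \<open>U\<close> of \<open>real ^ 4\<close> by a discrete group \<open>\<Gamma>\<close> of
  translations preserving \<open>U\<close>. Functions and tensors on \<open>U / \<Gamma>\<close> are \<open>\<Gamma>\<close>-invariant functions and
  tensors on \<open>U\<close>; values off \<open>U\<close> are irrelevant.
\<close>

type_synonym pt = "real ^ 4"
type_synonym vfield = "pt \<Rightarrow> pt"
type_synonym tensor2 = "pt \<Rightarrow> pt \<Rightarrow> pt \<Rightarrow> real"
type_synonym endo = "pt \<Rightarrow> pt \<Rightarrow> pt"

subsection \<open>Smooth maps, lattices and quotients\<close>

primrec Ck_on :: "nat \<Rightarrow> 'a::euclidean_space set \<Rightarrow> ('a \<Rightarrow> 'b::real_normed_vector) \<Rightarrow> bool" where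
  "Ck_on 0 U f \<longleftrightarrow> continuous_on U f"
| "Ck_on (Suc k) U f \<longleftrightarrow>
     f differentiable_on U \<and> (\<forall>v. Ck_on k U (\<lambda>p. frechet_derivative f (at p) v))"

text \<open>Only used for open \<open>U\<close>, where \<open>at p\<close> and \<open>at p within U\<close> agree.\<close>

definition smooth_on :: "'a::euclidean_space set \<Rightarrow> ('a \<Rightarrow> 'b::real_normed_vector) \<Rightarrow> bool" where
  "smooth_on U f \<longleftrightarrow> (\<forall>k. Ck_on k U f)"

definition generates_lattice :: "'a::euclidean_space set \<Rightarrow> 'a set \<Rightarrow> bool" where
  "generates_lattice B L \<longleftrightarrow>
     independent B \<and> L = {\<Sum>b\<in>B. real_of_int (n b) *\<^sub>R b |n. True}"

definition discrete_lattice :: "'a::euclidean_space set \<Rightarrow> bool" where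
  "discrete_lattice L \<longleftrightarrow> (\<exists>B. generates_lattice B L)"

definition full_lattice :: "'a::euclidean_space set \<Rightarrow> bool" where
  "full_lattice L \<longleftrightarrow> (\<exists>B. generates_lattice B L \<and> span B = UNIV)"

definition quotient_manifold :: "pt set \<Rightarrow> pt set \<Rightarrow> bool" where
  "quotient_manifold U \<Gamma> \<longleftrightarrow>
     open U \<and> U \<noteq> {} \<and> discrete_lattice \<Gamma> \<and> (\<forall>p\<in>U. \<forall>\<gamma>\<in>\<Gamma>. p + \<gamma> \<in> U)"

definition descends :: "pt set \<Rightarrow> pt set \<Rightarrow> (pt \<Rightarrow> 'a) \<Rightarrow> bool" where
  "descends U \<Gamma> T \<longleftrightarrow> (\<forall>p\<in>U. \<forall>\<gamma>\<in>\<Gamma>. T (p + \<gamma>) = T p)"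

subsection \<open>Metrics, conformal classes, complex and Kaehler structures\<close>

definition smooth_tensor2 :: "pt set \<Rightarrow> tensor2 \<Rightarrow> bool" where
  "smooth_tensor2 U T \<longleftrightarrow> (\<forall>p\<in>U. bilinear (T p)) \<and> (\<forall>v w. smooth_on U (\<lambda>p. T p v w))"

definition riemannian_metric :: "pt set \<Rightarrow> pt set \<Rightarrow> tensor2 \<Rightarrow> bool" where
  "riemannian_metric U \<Gamma> g \<longleftrightarrow>
     smooth_tensor2 U g \<and> descends U \<Gamma> g \<and>
     (\<forall>p\<in>U. (\<forall>v w. g p v w = g p w v) \<and> (\<forall>v. v \<noteq> 0 \<longrightarrow> g p v v > 0))"

definition conformal_class :: "pt set \<Rightarrow> pt set \<Rightarrow> tensor2 \<Rightarrow> tensor2 set" where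
  "conformal_class U \<Gamma> g =
     {h. \<exists>u. smooth_on U u \<and> descends U \<Gamma> u \<and>
           (\<forall>p\<in>U. u p > 0 \<and> (\<forall>v w. h p v w = u p * g p v w)) \<and> descends U \<Gamma> h}"

definition lie_bracket :: "vfield \<Rightarrow> vfield \<Rightarrow> vfield" where
  "lie_bracket X Y p = frechet_derivative Y (at p) (X p) - frechet_derivative X (at p) (Y p)"

definition app_endo :: "endo \<Rightarrow> vfield \<Rightarrow> vfield" where
  "app_endo J X p = J p (X p)"

definition nijenhuis :: "endo \<Rightarrow> vfield \<Rightarrow> vfield \<Rightarrow> vfield" where
  "nijenhuis J X Y p =
     lie_bracket (app_endo J X) (app_endo J Y) p
     - J p (lie_bracket (app_endo J X) Y p) - J p (lie_bracket X (app_endo J Y) p)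
     - lie_bracket X Y p"

definition complex_structure :: "pt set \<Rightarrow> pt set \<Rightarrow> endo \<Rightarrow> bool" where
  "complex_structure U \<Gamma> J \<longleftrightarrow>
     (\<forall>p\<in>U. linear (J p) \<and> (\<forall>v. J p (J p v) = - v)) \<and>
     (\<forall>v. smooth_on U (\<lambda>p. J p v)) \<and> descends U \<Gamma> J \<and>
     (\<forall>X Y. smooth_on U X \<longrightarrow> smooth_on U Y \<longrightarrow> (\<forall>p\<in>U. nijenhuis J X Y p = 0))"

definition hermitian :: "pt set \<Rightarrow> tensor2 \<Rightarrow> endo \<Rightarrow> bool" where
  "hermitian U g J \<longleftrightarrow> (\<forall>p\<in>U. \<forall>v w. g p (J p v) (J p w) = g p v w)"

text \<open>For each \<open>p\<close> the orientation of \<open>J\<close> is that of the bases \<open>(v, J v, w, J w)\<close>.\<close>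

definition J_det :: "endo \<Rightarrow> pt \<Rightarrow> pt \<Rightarrow> pt \<Rightarrow> real" where
  "J_det J p v w = det (vector [v, J p v, w, J p w] :: real ^ 4 ^ 4)"

definition opposite_orientations :: "pt set \<Rightarrow> endo \<Rightarrow> endo \<Rightarrow> bool" where
  "opposite_orientations U J J' \<longleftrightarrow>
     (\<forall>p\<in>U. \<forall>v w v' w'. J_det J p v w \<noteq> 0 \<longrightarrow> J_det J' p v' w' \<noteq> 0 \<longrightarrow>
        sgn (J_det J p v w) = - sgn (J_det J' p v' w'))"

definition fundamental_form :: "tensor2 \<Rightarrow> endo \<Rightarrow> tensor2" where
  "fundamental_form g J p v w = g p (J p v) w"

text \<open>The exterior derivative evaluated on constant vector fields, whose brackets vanish.\<close>

definition ext_deriv2 :: "tensor2 \<Rightarrow> pt \<Rightarrow> pt \<Rightarrow> pt \<Rightarrow> pt \<Rightarrow> real" where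
  "ext_deriv2 \<omega> p u v w =
     frechet_derivative (\<lambda>q. \<omega> q v w) (at p) u
     + frechet_derivative (\<lambda>q. \<omega> q w u) (at p) v
     + frechet_derivative (\<lambda>q. \<omega> q u v) (at p) w"

definition kaehler :: "pt set \<Rightarrow> pt set \<Rightarrow> tensor2 \<Rightarrow> endo \<Rightarrow> bool" where
  "kaehler U \<Gamma> g J \<longleftrightarrow>
     riemannian_metric U \<Gamma> g \<and> complex_structure U \<Gamma> J \<and> hermitian U g J \<and>
     (\<forall>p\<in>U. \<forall>u v w. ext_deriv2 (fundamental_form g J) p u v w = 0)"

subsection \<open>Torus actions\<close>

text \<open>
  An effective action of the torus \<open>real ^ 2 / \<Lambda>\<close> on \<open>U / \<Gamma>\<close>, given by its lift to an action of
  \<open>real ^ 2\<close> on \<open>U\<close>. Its Lie algebra \<open>real ^ 2\<close> is identified with the space of generators.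
\<close>

definition torus_action ::
  "pt set \<Rightarrow> pt set \<Rightarrow> (real ^ 2) set \<Rightarrow> (real ^ 2 \<Rightarrow> pt \<Rightarrow> pt) \<Rightarrow> bool" where
  "torus_action U \<Gamma> \<Lambda> \<rho> \<longleftrightarrow>
     full_lattice \<Lambda> \<and> smooth_on (UNIV \<times> U) (\<lambda>(s, p). \<rho> s p) \<and>
     (\<forall>p\<in>U. \<rho> 0 p = p) \<and>
     (\<forall>s s'. \<forall>p\<in>U. \<rho> s p \<in> U \<and> \<rho> (s + s') p = \<rho> s (\<rho> s' p)) \<and>
     (\<forall>s. \<forall>p\<in>U. \<forall>\<gamma>\<in>\<Gamma>. \<rho> s (p + \<gamma>) = \<rho> s p + \<gamma>) \<and>
     (\<forall>s. (\<forall>p\<in>U. \<exists>\<gamma>\<in>\<Gamma>. \<rho> s p = p + \<gamma>) \<longleftrightarrow> s \<in> \<Lambda>)"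

definition generator :: "(real ^ 2 \<Rightarrow> pt \<Rightarrow> pt) \<Rightarrow> real ^ 2 \<Rightarrow> vfield" where
  "generator \<rho> a p = vector_derivative (\<lambda>\<tau>. \<rho> (\<tau> *\<^sub>R a) p) (at 0)"

definition acts_by_isometries :: "pt set \<Rightarrow> tensor2 \<Rightarrow> (real ^ 2 \<Rightarrow> pt \<Rightarrow> pt) \<Rightarrow> bool" where
  "acts_by_isometries U g \<rho> \<longleftrightarrow>
     (\<forall>s. \<forall>p\<in>U. \<forall>v w.
        g (\<rho> s p) (frechet_derivative (\<rho> s) (at p) v) (frechet_derivative (\<rho> s) (at p) w)
        = g p v w)"

text \<open>The momentum map takes values in the dual of the Lie algebra, here \<open>real ^ 2\<close> via \<open>\<bullet>\<close>.\<close>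

definition hamiltonian ::
  "pt set \<Rightarrow> pt set \<Rightarrow> tensor2 \<Rightarrow> (real ^ 2 \<Rightarrow> pt \<Rightarrow> pt) \<Rightarrow> bool" where
  "hamiltonian U \<Gamma> \<omega> \<rho> \<longleftrightarrow>
     (\<exists>\<mu> :: pt \<Rightarrow> real ^ 2. smooth_on U \<mu> \<and> descends U \<Gamma> \<mu> \<and>
        (\<forall>s. \<forall>p\<in>U. \<mu> (\<rho> s p) = \<mu> p) \<and>
        (\<forall>a. \<forall>p\<in>U. \<forall>v. frechet_derivative (\<lambda>q. a \<bullet> \<mu> q) (at p) v
                          = - \<omega> p (generator \<rho> a p) v))"

subsection \<open>Ambitoric structures\<close>

definition ambitoric ::
  "pt set \<Rightarrow> pt set \<Rightarrow> tensor2 set \<Rightarrow> endo \<Rightarrow> endo \<Rightarrow> tensor2 \<Rightarrow> tensor2 \<Rightarrow>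
   (real ^ 2) set \<Rightarrow> (real ^ 2 \<Rightarrow> pt \<Rightarrow> pt) \<Rightarrow> bool" where
  "ambitoric U \<Gamma> c Jp Jm gp gm \<Lambda> \<rho> \<longleftrightarrow>
     quotient_manifold U \<Gamma> \<and>
     (\<exists>g. riemannian_metric U \<Gamma> g \<and> c = conformal_class U \<Gamma> g) \<and>
     (\<forall>h\<in>c. hermitian U h Jp \<and> hermitian U h Jm) \<and>
     opposite_orientations U Jp Jm \<and>
     gp \<in> c \<and> kaehler U \<Gamma> gp Jp \<and>
     gm \<in> c \<and> kaehler U \<Gamma> gm Jm \<and>
     torus_action U \<Gamma> \<Lambda> \<rho> \<and>
     acts_by_isometries U gp \<rho> \<and> hamiltonian U \<Gamma> (fundamental_form gp Jp) \<rho> \<and>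
     acts_by_isometries U gm \<rho> \<and> hamiltonian U \<Gamma> (fundamental_form gm Jm) \<rho>"

definition barycentric ::
  "pt set \<Rightarrow> tensor2 \<Rightarrow> tensor2 \<Rightarrow> (pt \<Rightarrow> real) \<Rightarrow> tensor2 \<Rightarrow> bool" where
  "barycentric U gp gm f g0 \<longleftrightarrow>
     smooth_on U f \<and>
     (\<forall>p\<in>U. f p > 0 \<and>
        (\<forall>v w. gm p v w = (f p)\<^sup>2 * gp p v w \<and>
               g0 p v w = f p * gp p v w \<and> g0 p v w = inverse (f p) * gm p v w))"

text \<open>
  The subspace of the Lie algebra of generators lying at \<open>p\<close> in the \<open>\<epsilon>\<close>-eigenspace of
  \<open>- Jp Jm\<close>; a point of the projective line of the Lie algebra where the generators have rank 2.
\<close>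

definition eigen_line ::
  "endo \<Rightarrow> endo \<Rightarrow> (real ^ 2 \<Rightarrow> pt \<Rightarrow> pt) \<Rightarrow> real \<Rightarrow> pt \<Rightarrow> (real ^ 2) set" where
  "eigen_line Jp Jm \<rho> \<epsilon> p =
     {a. - Jp p (Jm p (generator \<rho> a p)) = \<epsilon> *\<^sub>R generator \<rho> a p}"

text \<open>
  \<open>d\<xi> \<and> d\<eta> \<noteq> 0\<close> at \<open>p\<close> for maps \<open>\<xi>\<close>, \<open>\<eta>\<close> to the projective line, in affine charts
  \<open>s \<mapsto> span {s e + e'}\<close>. Changing a chart multiplies its differential by a nonzero factor.
\<close>

definition affine_coord_near ::
  "pt \<Rightarrow> (pt \<Rightarrow> (real ^ 2) set) \<Rightarrow> (pt \<Rightarrow> real) \<Rightarrow> bool" where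
  "affine_coord_near p \<zeta> z \<longleftrightarrow>
     (\<exists>W e e'. open W \<and> p \<in> W \<and> e \<noteq> e' \<and> independent {e, e'} \<and>
        smooth_on W z \<and> (\<forall>q\<in>W. \<zeta> q = span {z q *\<^sub>R e + e'}))"

definition proj_wedge_nonzero ::
  "pt \<Rightarrow> (pt \<Rightarrow> (real ^ 2) set) \<Rightarrow> (pt \<Rightarrow> (real ^ 2) set) \<Rightarrow> bool" where
  "proj_wedge_nonzero p \<xi> \<eta> \<longleftrightarrow>
     (\<exists>x y v w. affine_coord_near p \<xi> x \<and> affine_coord_near p \<eta> y \<and>
        frechet_derivative x (at p) v * frechet_derivative y (at p) w
        - frechet_derivative x (at p) w * frechet_derivative y (at p) v \<noteq> 0)"

definition regular_ambitoric ::
  "pt set \<Rightarrow> endo \<Rightarrow> endo \<Rightarrow> (real ^ 2 \<Rightarrow> pt \<Rightarrow> pt) \<Rightarrow> bool" where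
  "regular_ambitoric U Jp Jm \<rho> \<longleftrightarrow>
     (\<exists>W. open W \<and> W \<subseteq> U \<and> U \<subseteq> closure W \<and>
        (\<forall>p\<in>W. inj (\<lambda>a. generator \<rho> a p) \<and>
           proj_wedge_nonzero p (eigen_line Jp Jm \<rho> 1) (eigen_line Jp Jm \<rho> (- 1))))"

subsection \<open>Coordinates and the hyperbolic form\<close>

definition coordinates_on :: "pt set \<Rightarrow> (pt \<Rightarrow> pt) \<Rightarrow> bool" where
  "coordinates_on U \<Phi> \<longleftrightarrow>
     smooth_on U \<Phi> \<and> inj_on \<Phi> U \<and> open (\<Phi> ` U) \<and> smooth_on (\<Phi> ` U) (inv_into U \<Phi>)"

definition coord_field :: "(pt \<Rightarrow> pt) \<Rightarrow> 4 \<Rightarrow> vfield" where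
  "coord_field \<Phi> i p = inv (frechet_derivative \<Phi> (at p)) (axis i 1)"

definition pullback :: "(pt \<Rightarrow> pt) \<Rightarrow> tensor2 \<Rightarrow> tensor2" where
  "pullback \<Phi> T p v w =
     T (\<Phi> p) (frechet_derivative \<Phi> (at p) v) (frechet_derivative \<Phi> (at p) w)"

definition field_span :: "pt set \<Rightarrow> vfield \<Rightarrow> vfield \<Rightarrow> vfield set" where
  "field_span U X Y = {restrict (\<lambda>p. c *\<^sub>R X p + d *\<^sub>R Y p) U |c d. True}"

definition torus_fields :: "pt set \<Rightarrow> (real ^ 2 \<Rightarrow> pt \<Rightarrow> pt) \<Rightarrow> vfield set" where
  "torus_fields U \<rho> = {restrict (generator \<rho> a) U |a. True}"

text \<open>In these forms the components of a point are \<open>(x, y, t\<^sub>1, t\<^sub>2)\<close>.\<close>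

definition wedge :: "(pt \<Rightarrow> real) \<Rightarrow> (pt \<Rightarrow> real) \<Rightarrow> pt \<Rightarrow> pt \<Rightarrow> real" where
  "wedge \<sigma> \<tau> v w = \<sigma> v * \<tau> w - \<sigma> w * \<tau> v"

definition hyperbolic_metric :: "(real \<Rightarrow> real) \<Rightarrow> (real \<Rightarrow> real) \<Rightarrow> tensor2" where
  "hyperbolic_metric A B q v w =
     (let x = q $ 1; y = q $ 2;
          \<sigma> = (\<lambda>u::pt. u $ 3 + y\<^sup>2 * u $ 4);
          \<tau> = (\<lambda>u::pt. u $ 3 + x\<^sup>2 * u $ 4)
      in v $ 1 * w $ 1 / A x + v $ 2 * w $ 2 / B y
         + A x * (\<sigma> v * \<sigma> w) / (x\<^sup>2 - y\<^sup>2)\<^sup>2 + B y * (\<tau> v * \<tau> w) / (x\<^sup>2 - y\<^sup>2)\<^sup>2)"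

text \<open>\<open>\<epsilon> = 1\<close> and \<open>\<epsilon> = - 1\<close> give the two signs.\<close>

definition hyperbolic_form :: "real \<Rightarrow> tensor2" where
  "hyperbolic_form \<epsilon> q v w =
     (let x = q $ 1; y = q $ 2;
          \<sigma> = (\<lambda>u::pt. u $ 3 + y\<^sup>2 * u $ 4);
          \<tau> = (\<lambda>u::pt. u $ 3 + x\<^sup>2 * u $ 4)
      in wedge (\<lambda>u. u $ 1) \<sigma> v w / (x + \<epsilon> * y)\<^sup>2
         + \<epsilon> * (wedge (\<lambda>u. u $ 2) \<tau> v w / (x + \<epsilon> * y)\<^sup>2))"

subsection \<open>Ricci curvature\<close>

definition partial :: "4 \<Rightarrow> (pt \<Rightarrow> real) \<Rightarrow> pt \<Rightarrow> real" where
  "partial i h p = frechet_derivative h (at p) (axis i 1)"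

definition metric_matrix :: "tensor2 \<Rightarrow> pt \<Rightarrow> real ^ 4 ^ 4" where
  "metric_matrix g p = (\<chi> i j. g p (axis i 1) (axis j 1))"

definition christoffel :: "tensor2 \<Rightarrow> 4 \<Rightarrow> 4 \<Rightarrow> 4 \<Rightarrow> pt \<Rightarrow> real" where
  "christoffel g k i j p =
     (\<Sum>l\<in>UNIV. matrix_inv (metric_matrix g p) $ k $ l *
        (partial i (\<lambda>q. metric_matrix g q $ j $ l) p
         + partial j (\<lambda>q. metric_matrix g q $ i $ l) p
         - partial l (\<lambda>q. metric_matrix g q $ i $ j) p)) / 2"

definition ricci :: "tensor2 \<Rightarrow> 4 \<Rightarrow> 4 \<Rightarrow> pt \<Rightarrow> real" where
  "ricci g i j p =
     (\<Sum>k\<in>UNIV. partial k (christoffel g k i j) p - partial j (christoffel g k i k) p)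
     + (\<Sum>k\<in>UNIV. \<Sum>l\<in>UNIV. christoffel g k k l p * christoffel g l i j p
                             - christoffel g k j l p * christoffel g l i k p)"

definition ricci_flat :: "pt set \<Rightarrow> tensor2 \<Rightarrow> bool" where
  "ricci_flat U g \<longleftrightarrow> (\<forall>p\<in>U. \<forall>i j. ricci g i j p = 0)"

subsection \<open>The Riemannian Kerr metric\<close>

text \<open>The components of a point are \<open>(r, \<theta>, t, \<phi>)\<close>.\<close>

definition kerr_Delta :: "real \<Rightarrow> real \<Rightarrow> pt \<Rightarrow> real" where
  "kerr_Delta M \<alpha> p = (p $ 1)\<^sup>2 - 2 * M * p $ 1 - \<alpha>\<^sup>2"

definition kerr_Sigma :: "real \<Rightarrow> pt \<Rightarrow> real" where
  "kerr_Sigma \<alpha> p = (p $ 1)\<^sup>2 - \<alpha>\<^sup>2 * (cos (p $ 2))\<^sup>2"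

definition kerr_region :: "real \<Rightarrow> real \<Rightarrow> pt set" where
  "kerr_region M \<alpha> = {p. kerr_Delta M \<alpha> p > 0 \<and> kerr_Sigma \<alpha> p > 0 \<and> 0 < p $ 2 \<and> p $ 2 < pi}"

definition kerr_metric :: "real \<Rightarrow> real \<Rightarrow> tensor2" where
  "kerr_metric M \<alpha> p v w =
     (let r = p $ 1; s = sin (p $ 2); \<Delta> = kerr_Delta M \<alpha> p; \<Sigma>' = kerr_Sigma \<alpha> p;
          \<sigma> = (\<lambda>u::pt. u $ 3 + \<alpha> * s\<^sup>2 * u $ 4);
          \<tau> = (\<lambda>u::pt. (r\<^sup>2 - \<alpha>\<^sup>2) * u $ 4 - \<alpha> * u $ 3)
      in \<Sigma>' * (v $ 1 * w $ 1 / \<Delta> + v $ 2 * w $ 2)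
         + \<Delta> / \<Sigma>' * (\<sigma> v * \<sigma> w) + s\<^sup>2 / \<Sigma>' * (\<tau> v * \<tau> w))"

definition time_translation :: vfield where
  "time_translation p = axis 3 1"

definition axial_rotation :: vfield where
  "axial_rotation p = axis 4 1"

definition tphi_shift :: "real ^ 2 \<Rightarrow> pt" where
  "tphi_shift s = s $ 1 *\<^sub>R axis 3 1 + s $ 2 *\<^sub>R axis 4 1"

definition tphi_action :: "real ^ 2 \<Rightarrow> pt \<Rightarrow> pt" where
  "tphi_action s p = p + tphi_shift s"

end

theory Submission
  imports Defs
begin

text \<open>
  In the coordinates x = r, y = \<alpha> cos \<theta>, t1 = t + \<alpha> \<phi>, t2 = - \<phi> / \<alpha> the coefficients
  \<Sigma> = (x + y) (x - y), \<Delta> = A(x) and \<alpha>^2 sin^2 \<theta> = B(y) of the Kerr metric become those of a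
  hyperbolic ambitoric metric, and the two one-forms squared in it are
  \<sigma> = dt + \<alpha> sin^2 \<theta> d\<phi> = dt1 + y^2 dt2 and
  \<tau> = (r^2 - \<alpha>^2) d\<phi> - \<alpha> dt = - \<alpha> (dt1 + x^2 dt2) (\<open>pullback_hyperbolic\<close>).
  The work below is done in the original coordinates (r, \<theta>, t, \<phi>), where every coefficient is a
  rational function of r, sin \<theta> and cos \<theta>, so that each tensor identity reduces to a polynomial
  identity modulo sin^2 + cos^2 = 1 and the definitions of \<Sigma> and \<Delta>.

  Both complex structures come from one family \<open>kerr_J\<close> with a sign \<epsilon>. Up to positive factors, the
  coframe (dr, d\<theta>, \<sigma>, \<tau>) is orthogonal, and the rescaled version \<open>kerr_coframe\<close> turns the
  metric into a sum of two multiples of Euclidean planes (1,3) and (2,4), and the endomorphism into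
  a constant one that rotates the first plane, and the second one in the direction \<epsilon>
  (\<open>kerr_metric_coframe\<close>, \<open>kerr_coframe_J\<close>). Hence J^2 = -1, compatibility with the metric, the
  opposite orientations (\<open>sgn_J_det_kerr\<close>) and the eigenlines of - Jp Jm (\<open>eigen_line_kerr\<close>) are
  linear algebra with constant matrices. The Nijenhuis expression depends on X and Y only through their
  values (\<open>nijenhuis_eq\<close>), so that its vanishing is a pointwise identity for J and its first
  derivatives (\<open>nijenhuis_kerr_J\<close>).

  With N = r + \<epsilon> \<alpha> cos \<theta>, the metric g / N^2 is Kaehler for the sign \<epsilon>: its fundamental form
  (dr \<and> \<sigma> + \<epsilon> sin \<theta> d\<theta> \<and> \<tau>) / N^2 is closed (\<open>ext_deriv2_kerr\<close>) and has the invariant moment map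
  \<open>kerr_moment\<close>. As the two factors N multiply to \<Sigma>, their ratio is f = (x + y) / (x - y), and
  the barycentric metric is g / \<Sigma>. The line-valued maps \<xi> and \<eta> are given in affine charts by
  r^2 - \<alpha>^2 and sin^2 \<theta>, which are independent away from the hyperplane \<theta> = pi / 2.

  Ricci-flatness does not follow from the ambitoric structure and is verified directly. The
  connection coefficients are written down, identified by lowering their upper index
  (\<open>kerr_Gamma_lowered\<close>), and differentiated. The contraction of the connection is the differential of
  log (\<Sigma> sin \<theta>), half the logarithm of the determinant of the metric, which keeps the second
  derivatives small; what remains is the algebraic identity \<open>kerr_ricci_identity\<close>.
\<close>

section \<open>Calculus of smooth maps\<close>

lemma has_derivative_cong_open:
  assumes "open U" "p \<in> U" "\<And>q. q \<in> U \<Longrightarrow> f q = h q"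
  shows "(f has_derivative D) (at p) \<longleftrightarrow> (h has_derivative D) (at p)"
  using has_derivative_transform_within_open[of f D p UNIV U h]
    has_derivative_transform_within_open[of h D p UNIV U f] assms by auto

lemma frechet_derivative_cong_open:
  assumes "open U" "p \<in> U" "\<And>q. q \<in> U \<Longrightarrow> f q = h q"
  shows "frechet_derivative f (at p) = frechet_derivative h (at p)"
  using has_derivative_cong_open[OF assms] by (simp add: frechet_derivative_def)

lemma differentiable_on_cong_open:
  assumes "open U" "f differentiable_on U" "\<And>q. q \<in> U \<Longrightarrow> f q = h q"
  shows "h differentiable_on U"
  using assms has_derivative_cong_open[OF assms(1) _ assms(3)]
  by (auto simp: differentiable_on_eq_differentiable_at differentiable_def)

text \<open>
  The Frechet derivative at a point of an open set only depends on the germ there, so regularity can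
  be transferred between a function and a formula for it that is valid on the open set only.
\<close>

lemma Ck_on_cong:
  assumes "open U" "Ck_on k U f" "\<And>p. p \<in> U \<Longrightarrow> f p = h p"
  shows "Ck_on k U h"
  using assms(2,3)
proof (induction k arbitrary: f h)
  case 0
  then show ?case using continuous_on_cong[of U U f h] by simp
next
  case (Suc k)
  have "Ck_on k U (\<lambda>p. frechet_derivative h (at p) v)" for v
  proof (rule Suc.IH)
    show "Ck_on k U (\<lambda>p. frechet_derivative f (at p) v)" using Suc.prems(1) by simp
    show "frechet_derivative f (at p) v = frechet_derivative h (at p) v" if "p \<in> U" for p
      using frechet_derivative_cong_open[OF assms(1) that Suc.prems(2)] by simp
  qed
  with Suc.prems differentiable_on_cong_open[OF assms(1), of f h] show ?case
    by simp
qed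

lemma Ck_on_SucI:
  assumes "open U" and "\<And>p. p \<in> U \<Longrightarrow> (f has_derivative D p) (at p)"
    and "\<And>v. Ck_on k U (\<lambda>p. D p v)"
  shows "Ck_on (Suc k) U f"
proof -
  have "Ck_on k U (\<lambda>p. frechet_derivative f (at p) v)" for v
    by (rule Ck_on_cong[OF assms(1,3)]) (use frechet_derivative_at[OF assms(2)] in simp)
  moreover have "f differentiable_on U"
    using assms(1,2) by (auto simp: differentiable_on_eq_differentiable_at differentiable_def)
  ultimately show ?thesis by simp
qed

lemma Ck_on_Suc_has_derivative:
  assumes "open U" "Ck_on (Suc k) U f" "p \<in> U"
  shows "(f has_derivative frechet_derivative f (at p)) (at p)"
  using assms frechet_derivative_works by (auto simp: differentiable_on_eq_differentiable_at)

lemma Ck_on_SucD: "Ck_on (Suc k) U f \<Longrightarrow> Ck_on k U f"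
  by (induction k arbitrary: f) (auto simp: differentiable_imp_continuous_on)

lemma Ck_on_const: "open U \<Longrightarrow> Ck_on k U (\<lambda>p. c)"
proof (induction k arbitrary: c)
  case (Suc k)
  show ?case by (rule Ck_on_SucI[where D = "\<lambda>p v. 0"]) (use Suc in auto)
qed simp

lemma Ck_on_compose_linear:
  assumes "open U" "bounded_linear l" "Ck_on k U f"
  shows "Ck_on k U (\<lambda>p. l (f p))"
  using assms(3)
proof (induction k arbitrary: f)
  case 0
  then show ?case
    using bounded_linear.continuous_on[OF assms(2)] by auto
next
  case (Suc k)
  show ?case
    by (rule Ck_on_SucI[OF assms(1) bounded_linear.has_derivative[OF assms(2)
          Ck_on_Suc_has_derivative[OF assms(1) Suc.prems]]])
      (use Suc in auto)
qed

lemma Ck_on_linear: "open U \<Longrightarrow> bounded_linear l \<Longrightarrow> Ck_on k U l"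
proof (cases k)
  case (Suc n)
  assume "open U" "bounded_linear l"
  then show ?thesis
    unfolding Suc by (intro Ck_on_SucI[where D = "\<lambda>p. l"] Ck_on_const bounded_linear_imp_has_derivative)
qed (simp add: linear_continuous_on)

lemma Ck_on_add:
  assumes "open U" "Ck_on k U f" "Ck_on k U h"
  shows "Ck_on k U (\<lambda>p. f p + h p)"
  using assms(2,3)
proof (induction k arbitrary: f h)
  case (Suc k)
  show ?case
    by (rule Ck_on_SucI[OF assms(1) has_derivative_add[OF Ck_on_Suc_has_derivative[OF assms(1) Suc.prems(1)]
            Ck_on_Suc_has_derivative[OF assms(1) Suc.prems(2)]]])
      (use Suc in auto)
qed (simp add: continuous_on_add)

lemma Ck_on_sum:
  assumes "open U" "finite I" "\<And>i. i \<in> I \<Longrightarrow> Ck_on k U (f i)"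
  shows "Ck_on k U (\<lambda>p. \<Sum>i\<in>I. f i p)"
  using assms(2,3) by induction (auto intro: Ck_on_const Ck_on_add assms(1))

lemma Ck_on_mult:
  fixes f h :: "'a::euclidean_space \<Rightarrow> real"
  assumes "open U" "Ck_on k U f" "Ck_on k U h"
  shows "Ck_on k U (\<lambda>p. f p * h p)"
  using assms(2,3)
proof (induction k arbitrary: f h)
  case (Suc k)
  show ?case
  proof (rule Ck_on_SucI[OF assms(1) has_derivative_mult[OF Ck_on_Suc_has_derivative[OF assms(1) Suc.prems(1)]
            Ck_on_Suc_has_derivative[OF assms(1) Suc.prems(2)]]])
    show "Ck_on k U (\<lambda>p. f p * frechet_derivative h (at p) v + frechet_derivative f (at p) v * h p)" for v
      using Suc.prems Ck_on_SucD[of k U] by (intro Ck_on_add assms(1) Suc.IH) auto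
  qed
qed (simp add: continuous_on_mult)

text \<open>
  A chain rule that raises the order by one, so that regularity of composites can be proved by
  climbing through the derivatives of the outer function.
\<close>

lemma Ck_on_chain:
  fixes f :: "'a::euclidean_space \<Rightarrow> real" and h h' :: "real \<Rightarrow> real"
  assumes U: "open U" and f: "Ck_on (Suc k) U f"
    and h: "\<And>p. p \<in> U \<Longrightarrow> (h has_field_derivative h' (f p)) (at (f p))"
    and h': "Ck_on k U (\<lambda>p. h' (f p))"
  shows "Ck_on (Suc k) U (\<lambda>p. h (f p))"
proof (rule Ck_on_SucI[OF U])
  show "((\<lambda>p. h (f p)) has_derivative (\<lambda>v. h' (f p) * frechet_derivative f (at p) v)) (at p)"
    if "p \<in> U" for p
    using has_derivative_compose[OF Ck_on_Suc_has_derivative[OF U f that]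
        h[OF that, unfolded has_field_derivative_def]] .
  show "Ck_on k U (\<lambda>p. h' (f p) * frechet_derivative f (at p) v)" for v
    using f by (intro Ck_on_mult U h') auto
qed

text \<open>
  If the derivative of \<open>h\<close> is as regular as \<open>h\<close> itself along \<open>f\<close>, for instance because it is an
  algebraic expression in \<open>h\<close> and smooth functions, then induction on the order bootstraps from
  continuity to smoothness. This covers the reciprocal, the square root and the arc cosine.
\<close>

lemma smooth_on_chainI:
  fixes f :: "'a::euclidean_space \<Rightarrow> real" and h h' :: "real \<Rightarrow> real"
  assumes U: "open U" and f: "smooth_on U f"
    and h: "\<And>p. p \<in> U \<Longrightarrow> (h has_field_derivative h' (f p)) (at (f p))"
    and step: "\<And>k. Ck_on k U (\<lambda>p. h (f p)) \<Longrightarrow> Ck_on k U (\<lambda>p. h' (f p))"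
  shows "smooth_on U (\<lambda>p. h (f p))"
proof -
  have "Ck_on k U (\<lambda>p. h (f p))" for k
  proof (induction k)
    case 0
    have "continuous_on U f" using f by (auto simp: smooth_on_def dest: spec[of _ 0])
    moreover have "continuous_on (f ` U) h"
      using h by (intro continuous_at_imp_continuous_on) (auto intro: DERIV_isCont)
    ultimately show ?case using continuous_on_compose2[of "f ` U" h U f] by simp
  next
    case (Suc k)
    then show ?case
      using f by (intro Ck_on_chain[where h = h and h' = h'] U h step) (auto simp: smooth_on_def simp del: Ck_on.simps)
  qed
  then show ?thesis by (simp add: smooth_on_def)
qed

lemma smooth_on_const: "open U \<Longrightarrow> smooth_on U (\<lambda>p. c)"
  by (simp add: smooth_on_def Ck_on_const)

lemma smooth_on_linear: "open U \<Longrightarrow> bounded_linear l \<Longrightarrow> smooth_on U l"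
  by (simp add: smooth_on_def Ck_on_linear)

lemma smooth_on_compose_linear:
  "open U \<Longrightarrow> bounded_linear l \<Longrightarrow> smooth_on U f \<Longrightarrow> smooth_on U (\<lambda>p. l (f p))"
  by (simp add: smooth_on_def Ck_on_compose_linear)

lemma smooth_on_cong:
  "open U \<Longrightarrow> smooth_on U f \<Longrightarrow> (\<And>p. p \<in> U \<Longrightarrow> f p = h p) \<Longrightarrow> smooth_on U h"
  unfolding smooth_on_def using Ck_on_cong by blast

lemma smooth_on_add:
  "open U \<Longrightarrow> smooth_on U f \<Longrightarrow> smooth_on U h \<Longrightarrow> smooth_on U (\<lambda>p. f p + h p)"
  by (simp add: smooth_on_def Ck_on_add)

lemma smooth_on_mult:
  fixes f h :: "'a::euclidean_space \<Rightarrow> real"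
  shows "open U \<Longrightarrow> smooth_on U f \<Longrightarrow> smooth_on U h \<Longrightarrow> smooth_on U (\<lambda>p. f p * h p)"
  by (simp add: smooth_on_def Ck_on_mult)

lemma smooth_on_minus:
  fixes f :: "'a::euclidean_space \<Rightarrow> real"
  shows "open U \<Longrightarrow> smooth_on U f \<Longrightarrow> smooth_on U (\<lambda>p. - f p)"
  by (rule smooth_on_compose_linear[OF _ bounded_linear_minus[OF bounded_linear_ident]])

lemma smooth_on_diff:
  fixes f h :: "'a::euclidean_space \<Rightarrow> real"
  shows "open U \<Longrightarrow> smooth_on U f \<Longrightarrow> smooth_on U h \<Longrightarrow> smooth_on U (\<lambda>p. f p - h p)"
  using smooth_on_add[of U f "\<lambda>p. - h p"] smooth_on_minus[of U h] by simp

lemma smooth_on_power: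
  fixes f :: "'a::euclidean_space \<Rightarrow> real"
  shows "open U \<Longrightarrow> smooth_on U f \<Longrightarrow> smooth_on U (\<lambda>p. f p ^ n)"
  by (induction n) (auto intro: smooth_on_const smooth_on_mult)

lemma smooth_on_inverse:
  fixes f :: "'a::euclidean_space \<Rightarrow> real"
  assumes "open U" "smooth_on U f" "\<And>p. p \<in> U \<Longrightarrow> f p \<noteq> 0"
  shows "smooth_on U (\<lambda>p. inverse (f p))"
proof (rule smooth_on_chainI[OF assms(1,2), where h' = "\<lambda>x. - 1 * (inverse x * inverse x)"])
  show "Ck_on k U (\<lambda>p. - 1 * (inverse (f p) * inverse (f p)))"
    if "Ck_on k U (\<lambda>p. inverse (f p))" for k
    by (intro Ck_on_mult Ck_on_const assms(1) that)
qed (use assms(3) in \<open>auto intro!: derivative_eq_intros\<close>)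

lemma smooth_on_divide:
  fixes f h :: "'a::euclidean_space \<Rightarrow> real"
  assumes "open U" "smooth_on U f" "smooth_on U h" "\<And>p. p \<in> U \<Longrightarrow> h p \<noteq> 0"
  shows "smooth_on U (\<lambda>p. f p / h p)"
  unfolding divide_inverse by (intro smooth_on_mult smooth_on_inverse assms)

text \<open>
  Sine and cosine are derivatives of each other up to sign, so they climb the orders together.
\<close>

lemma smooth_on_sin_cos:
  fixes f :: "'a::euclidean_space \<Rightarrow> real"
  assumes U: "open U" and f: "smooth_on U f"
  shows "smooth_on U (\<lambda>p. sin (f p))" "smooth_on U (\<lambda>p. cos (f p))"
proof -
  have "Ck_on k U (\<lambda>p. sin (f p)) \<and> Ck_on k U (\<lambda>p. cos (f p))" for k
  proof (induction k)
    case 0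
    have "continuous_on U f" using f by (auto simp: smooth_on_def dest: spec[of _ 0])
    then show ?case by (auto intro: continuous_intros)
  next
    case (Suc k)
    have "Ck_on (Suc k) U f" using f unfolding smooth_on_def by blast
    moreover have "Ck_on k U (\<lambda>p. - sin (f p))"
      using Suc by (intro Ck_on_compose_linear[OF U bounded_linear_minus[OF bounded_linear_ident]]) simp
    ultimately show ?case
      using Ck_on_chain[OF U, of k f sin cos] Ck_on_chain[OF U, of k f cos "\<lambda>x. - sin x"] Suc
      by (auto intro: DERIV_sin DERIV_cos simp del: Ck_on.simps)
  qed
  then show "smooth_on U (\<lambda>p. sin (f p))" "smooth_on U (\<lambda>p. cos (f p))"
    by (simp_all add: smooth_on_def)
qed

lemma smooth_on_sqrt:
  fixes f :: "'a::euclidean_space \<Rightarrow> real"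
  assumes "open U" "smooth_on U f" "\<And>p. p \<in> U \<Longrightarrow> f p > 0"
  shows "smooth_on U (\<lambda>p. sqrt (f p))"
proof (rule smooth_on_chainI[OF assms(1,2), where h' = "\<lambda>x. sqrt x * inverse (2 * x)"])
  show "(sqrt has_real_derivative sqrt (f p) * inverse (2 * f p)) (at (f p))" if "p \<in> U" for p
    using assms(3)[OF that]
    by (auto intro!: derivative_eq_intros simp: field_simps)
  have "smooth_on U (\<lambda>p. inverse (2 * f p))"
    by (intro smooth_on_inverse smooth_on_mult smooth_on_const assms) (use assms(3) in force)
  then show "Ck_on k U (\<lambda>p. sqrt (f p) * inverse (2 * f p))" if "Ck_on k U (\<lambda>p. sqrt (f p))" for k
    using that by (intro Ck_on_mult assms(1)) (auto simp: smooth_on_def)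
qed

lemma smooth_on_arccos:
  fixes f :: "'a::euclidean_space \<Rightarrow> real"
  assumes "open U" "smooth_on U f" "\<And>p. p \<in> U \<Longrightarrow> \<bar>f p\<bar> < 1"
  shows "smooth_on U (\<lambda>p. arccos (f p))"
proof (rule smooth_on_chainI[OF assms(1,2)])
  have b: "-1 < f p" "f p < 1" "1 - f p ^ 2 > 0" if "p \<in> U" for p
    using assms(3)[OF that] by (auto simp: abs_square_less_1)
  show "(arccos has_real_derivative inverse (- sqrt (1 - (f p)\<^sup>2))) (at (f p))" if "p \<in> U" for p
    using b[OF that] DERIV_arccos by blast
  have "smooth_on U (\<lambda>p. inverse (- sqrt (1 - (f p)\<^sup>2)))"
    by (intro smooth_on_inverse smooth_on_minus smooth_on_sqrt smooth_on_diff smooth_on_const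
        smooth_on_power assms) (use b in force)+
  then show "Ck_on k U (\<lambda>p. inverse (- sqrt (1 - (f p)\<^sup>2)))" for k
    by (simp add: smooth_on_def)
qed

lemma smooth_on_vecI:
  fixes f :: "'a::euclidean_space \<Rightarrow> real ^ 'n"
  assumes "open U" "\<And>i. smooth_on U (\<lambda>p. f p $ i)"
  shows "smooth_on U f"
proof -
  have l: "bounded_linear (\<lambda>x. x *\<^sub>R (axis i 1 :: real ^ 'n))" for i
    by (rule bounded_linear_scaleR_left)
  have "Ck_on k U (\<lambda>p. \<Sum>i\<in>UNIV. f p $ i *\<^sub>R (axis i 1 :: real ^ 'n))" for k
    using Ck_on_compose_linear[OF assms(1) l, of k "\<lambda>p. f p $ i" i for i] assms(2)
    by (intro Ck_on_sum assms(1)) (simp_all add: smooth_on_def)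
  moreover have "(\<lambda>p. \<Sum>i\<in>UNIV. f p $ i *\<^sub>R axis i 1) = f"
    using basis_expansion[of "f p" for p] by (simp add: scalar_mult_eq_scaleR fun_eq_iff)
  ultimately show ?thesis by (simp add: smooth_on_def)
qed

lemma smooth_on_nth: "open U \<Longrightarrow> smooth_on U (\<lambda>p :: real ^ 'n. p $ i)"
  by (rule smooth_on_linear[OF _ bounded_linear_vec_nth])

lemma smooth_on_differentiable:
  assumes "open U" "smooth_on U f" "p \<in> U"
  shows "(f has_derivative frechet_derivative f (at p)) (at p)"
  using Ck_on_Suc_has_derivative[of U 0 f p] assms unfolding smooth_on_def by blast

lemmas smooth_intros = smooth_on_const smooth_on_nth smooth_on_add smooth_on_diff smooth_on_minus
  smooth_on_mult smooth_on_power smooth_on_divide smooth_on_sin_cos smooth_on_arccos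

lemma has_derivative_vec_nth:
  "((\<lambda>q. q $ i) has_derivative (\<lambda>v. v $ i)) F"
  by (rule bounded_linear.has_derivative[OF bounded_linear_vec_nth has_derivative_ident])

lemma has_derivative_vecI:
  fixes f :: "'a::real_normed_vector \<Rightarrow> real ^ 'n"
  assumes "\<And>i. ((\<lambda>q. f q $ i) has_derivative (\<lambda>u. D u $ i)) (at p)"
  shows "(f has_derivative D) (at p)"
proof -
  have exp: "(\<Sum>i\<in>UNIV. x $ i *\<^sub>R axis i 1) = x" for x :: "real ^ 'n"
    using basis_expansion[of x] by (simp add: scalar_mult_eq_scaleR)
  have "((\<lambda>q. \<Sum>i\<in>UNIV. f q $ i *\<^sub>R axis i 1) has_derivative
      (\<lambda>u. \<Sum>i\<in>UNIV. D u $ i *\<^sub>R (axis i 1 :: real ^ 'n))) (at p)"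
    by (intro has_derivative_sum bounded_linear.has_derivative[OF bounded_linear_scaleR_left] assms)
  then show ?thesis by (simp add: exp)
qed

lemma vector_4 [simp]:
  "(vector [w, x, y, z] :: ('a::zero)^4) $ 1 = w"
  "(vector [w, x, y, z] :: ('a::zero)^4) $ 2 = x"
  "(vector [w, x, y, z] :: ('a::zero)^4) $ 3 = y"
  "(vector [w, x, y, z] :: ('a::zero)^4) $ 4 = z"
  unfolding vector_def by simp_all

section \<open>Functions of two coordinates\<close>

text \<open>
  All coefficient functions below depend only on the coordinates \<open>r\<close> and \<open>\<theta>\<close>. The predicate says
  that \<open>h\<close> is differentiable at \<open>p\<close> with differential \<open>a dr + b d\<theta>\<close>; the numbers \<open>a\<close>, \<open>b\<close> can then be
  computed by resolution with \<open>grad2_intros\<close>.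
\<close>

definition grad2 :: "(pt \<Rightarrow> real) \<Rightarrow> pt \<Rightarrow> real \<Rightarrow> real \<Rightarrow> bool" where
  "grad2 h p a b \<longleftrightarrow> (h has_derivative (\<lambda>v. a * v $ 1 + b * v $ 2)) (at p)"

lemma grad2_cong: "grad2 h p a b \<Longrightarrow> a = a' \<Longrightarrow> b = b' \<Longrightarrow> grad2 h p a' b'"
  by simp

lemma grad2_const: "grad2 (\<lambda>q. k) p 0 0"
  by (simp add: grad2_def)

lemma grad2_r: "grad2 (\<lambda>q. q $ 1) p 1 0"
  using has_derivative_vec_nth[of 1] by (simp add: grad2_def)

lemma grad2_sin: "grad2 (\<lambda>q. sin (q $ 2)) p 0 (cos (p $ 2))"
  unfolding grad2_def by (auto intro!: derivative_eq_intros has_derivative_vec_nth)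

lemma grad2_cos: "grad2 (\<lambda>q. cos (q $ 2)) p 0 (- sin (p $ 2))"
  unfolding grad2_def by (auto intro!: derivative_eq_intros has_derivative_vec_nth)

lemma grad2_add:
  "grad2 f p a b \<Longrightarrow> grad2 h p a' b' \<Longrightarrow> grad2 (\<lambda>q. f q + h q) p (a + a') (b + b')"
  unfolding grad2_def
  by (drule (1) has_derivative_add, erule has_derivative_eq_rhs) (simp add: fun_eq_iff algebra_simps)

lemma grad2_diff:
  "grad2 f p a b \<Longrightarrow> grad2 h p a' b' \<Longrightarrow> grad2 (\<lambda>q. f q - h q) p (a - a') (b - b')"
  unfolding grad2_def
  by (drule (1) has_derivative_diff, erule has_derivative_eq_rhs) (simp add: fun_eq_iff algebra_simps)

lemma grad2_minus: "grad2 f p a b \<Longrightarrow> grad2 (\<lambda>q. - f q) p (- a) (- b)"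
  unfolding grad2_def
  by (drule has_derivative_minus, erule has_derivative_eq_rhs) (simp add: fun_eq_iff algebra_simps)

lemma grad2_mult:
  "grad2 f p a b \<Longrightarrow> grad2 h p a' b' \<Longrightarrow>
   grad2 (\<lambda>q. f q * h q) p (f p * a' + a * h p) (f p * b' + b * h p)"
  unfolding grad2_def
  by (drule (1) has_derivative_mult, erule has_derivative_eq_rhs) (simp add: fun_eq_iff algebra_simps)

lemma grad2_chain:
  assumes "grad2 f p a b" "(h has_field_derivative d) (at (f p))"
  shows "grad2 (\<lambda>q. h (f q)) p (d * a) (d * b)"
proof -
  have "(h has_derivative (\<lambda>t. d * t)) (at (f p))"
    using assms(2) by (simp add: has_field_derivative_def)
  from has_derivative_compose[OF assms(1)[unfolded grad2_def] this]
  show ?thesis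
    unfolding grad2_def by (rule has_derivative_eq_rhs) (simp add: fun_eq_iff algebra_simps)
qed

lemma grad2_power:
  "grad2 f p a b \<Longrightarrow>
   grad2 (\<lambda>q. f q ^ n) p (of_nat n * f p ^ (n - 1) * a) (of_nat n * f p ^ (n - 1) * b)"
  by (erule grad2_chain) (use DERIV_pow[of n] in simp)

lemma grad2_divide:
  assumes "grad2 f p a b" "grad2 h p a' b'" "h p \<noteq> 0"
  shows "grad2 (\<lambda>q. f q / h q) p (a / h p - f p * a' / (h p)\<^sup>2) (b / h p - f p * b' / (h p)\<^sup>2)"
  using grad2_mult[OF assms(1) grad2_chain[OF assms(2) DERIV_inverse[OF assms(3)]]]
  by (simp add: divide_inverse power2_eq_square mult_ac)

lemma grad2_Delta: "grad2 (kerr_Delta M \<alpha>) p (2 * (p $ 1 - M)) 0"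
  unfolding grad2_def kerr_Delta_def
  by (auto intro!: derivative_eq_intros has_derivative_vec_nth simp: algebra_simps)

lemma grad2_Sigma:
  "grad2 (kerr_Sigma \<alpha>) p (2 * p $ 1) (2 * \<alpha>\<^sup>2 * cos (p $ 2) * sin (p $ 2))"
  unfolding grad2_def kerr_Sigma_def
  by (auto intro!: derivative_eq_intros has_derivative_vec_nth simp: algebra_simps)

lemmas grad2_intros = grad2_const grad2_r grad2_sin grad2_cos grad2_Delta grad2_Sigma
  grad2_add grad2_diff grad2_minus grad2_mult grad2_power grad2_divide

lemma grad2_frechet:
  "grad2 h p a b \<Longrightarrow> frechet_derivative h (at p) = (\<lambda>v. a * v $ 1 + b * v $ 2)"
  unfolding grad2_def using frechet_derivative_at[of h _ p] by simp

lemma grad2_partial: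
  assumes "grad2 h p a b"
  shows "partial 1 h p = a" "partial 2 h p = b" "partial 3 h p = 0" "partial 4 h p = 0"
proof -
  have "frechet_derivative h (at p) = (\<lambda>v. a * v $ 1 + b * v $ 2)"
    using frechet_derivative_at[OF assms[unfolded grad2_def]] by simp
  then show "partial 1 h p = a" "partial 2 h p = b" "partial 3 h p = 0" "partial 4 h p = 0"
    by (simp_all add: partial_def axis_def)
qed

lemma partial_eqI:
  assumes "grad2 h p a b"
  shows "a = d \<Longrightarrow> partial 1 h p = d" "b = d \<Longrightarrow> partial 2 h p = d"
  using grad2_partial[OF assms] by simp_all

lemma partial_cong:
  assumes "open U" "p \<in> U" "\<And>q. q \<in> U \<Longrightarrow> f q = h q"
  shows "partial i f p = partial i h p"
  by (simp add: partial_def frechet_derivative_cong_open[OF assms])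

text \<open>
  The derivative of a sum is the sum of the derivatives only if the summands are differentiable, since
  \<open>frechet_derivative\<close> has an arbitrary value otherwise.
\<close>

lemma partial_sum:
  assumes "\<And>k. \<exists>a b. grad2 (f k) p a b"
  shows "(\<Sum>k\<in>UNIV. partial i (f k) p) = partial i (\<lambda>q. \<Sum>k\<in>(UNIV :: 4 set). f k q) p"
proof -
  have "((f k) has_derivative frechet_derivative (f k) (at p)) (at p)" for k
    using assms[of k] frechet_derivative_works unfolding grad2_def differentiable_def by blast
  then have "((\<lambda>q. \<Sum>k\<in>(UNIV :: 4 set). f k q) has_derivative
      (\<lambda>v. \<Sum>k\<in>UNIV. frechet_derivative (f k) (at p) v)) (at p)"
    by (intro has_derivative_sum)
  from frechet_derivative_at[OF this, symmetric] show ?thesis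
    by (simp add: partial_def)
qed

section \<open>The Kerr metric and its coframe\<close>

text \<open>
  Modulo these three relations the identities below are polynomial.
\<close>

lemma kerr_relations:
  "kerr_Sigma \<alpha> p = (p $ 1)\<^sup>2 - \<alpha>\<^sup>2 * (cos (p $ 2))\<^sup>2"
  "kerr_Delta M \<alpha> p = (p $ 1)\<^sup>2 - 2 * M * p $ 1 - \<alpha>\<^sup>2"
  "(sin (p $ 2))\<^sup>2 = 1 - (cos (p $ 2))\<^sup>2"
  by (simp_all add: kerr_Sigma_def kerr_Delta_def sin_squared_eq)

lemma kerr_region_nonzero:
  assumes "p \<in> kerr_region M \<alpha>"
  shows "kerr_Sigma \<alpha> p \<noteq> 0" "kerr_Delta M \<alpha> p \<noteq> 0" "sin (p $ 2) \<noteq> 0"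
  using assms sin_gt_zero[of "p $ 2"] by (auto simp: kerr_region_def)

lemma open_kerr_region: "open (kerr_region M \<alpha>)"
proof -
  have "kerr_region M \<alpha> = {p. 0 < kerr_Delta M \<alpha> p} \<inter> {p. 0 < kerr_Sigma \<alpha> p} \<inter>
      {p. 0 < p $ 2} \<inter> {p. p $ 2 < pi}"
    by (auto simp: kerr_region_def)
  also have "open \<dots>"
    unfolding kerr_Delta_def kerr_Sigma_def
    by (intro open_Int open_Collect_less continuous_intros)
  finally show ?thesis .
qed

text \<open>
  Far out on the equatorial plane the radial polynomial is positive.
\<close>

lemma kerr_region_nonempty: "kerr_region M \<alpha> \<noteq> {}"
proof -
  define r where "r = 1 + 2 * \<bar>M\<bar> + \<bar>\<alpha>\<bar>"
  have r: "r \<ge> 1 + \<bar>\<alpha>\<bar>" "r - 2 * M \<ge> 1 + \<bar>\<alpha>\<bar>" by (auto simp: r_def)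
  have "\<alpha>\<^sup>2 = \<bar>\<alpha>\<bar> * \<bar>\<alpha>\<bar>" by (simp add: power2_eq_square)
  also have "\<dots> < (1 + \<bar>\<alpha>\<bar>) * (1 + \<bar>\<alpha>\<bar>)" by (intro mult_strict_mono) auto
  also have "\<dots> \<le> r * (r - 2 * M)" using r by (intro mult_mono) auto
  finally have "0 < r\<^sup>2 - 2 * M * r - \<alpha>\<^sup>2" by (simp add: algebra_simps power2_eq_square)
  then have "vector [r, pi / 2, 0, 0] \<in> kerr_region M \<alpha>"
    using r by (auto simp: kerr_region_def kerr_Delta_def kerr_Sigma_def)
  then show ?thesis by blast
qed

lemma smooth_on_kerr_Sigma: "open U \<Longrightarrow> smooth_on U (kerr_Sigma \<alpha>)"
  unfolding kerr_Sigma_def[abs_def] by (intro smooth_intros)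

lemma smooth_on_kerr_Delta: "open U \<Longrightarrow> smooth_on U (kerr_Delta M \<alpha>)"
  unfolding kerr_Delta_def[abs_def] by (intro smooth_intros)

lemma smooth_on_kerr_metric: "smooth_on (kerr_region M \<alpha>) (\<lambda>p. kerr_metric M \<alpha> p v w)"
  unfolding kerr_metric_def Let_def
  by (intro smooth_intros open_kerr_region smooth_on_kerr_Sigma smooth_on_kerr_Delta kerr_region_nonzero)

lemma kerr_metric_bilinear: "bilinear (kerr_metric M \<alpha> p)"
  unfolding bilinear_def kerr_metric_def Let_def
  by (auto intro!: linearI simp: algebra_simps add_divide_distrib)

lemma kerr_metric_sym: "kerr_metric M \<alpha> p v w = kerr_metric M \<alpha> p w v"
  by (simp add: kerr_metric_def Let_def mult_ac)

text \<open>
  The scaling of the first two components is chosen such that the complex structures become constant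
  in this coframe.
\<close>

definition kerr_coframe :: "real \<Rightarrow> real \<Rightarrow> pt \<Rightarrow> pt \<Rightarrow> pt" where
  "kerr_coframe M \<alpha> p v =
     (let r = p $ 1; s = sin (p $ 2); S = kerr_Sigma \<alpha> p; D = kerr_Delta M \<alpha> p in
      vector [S / D * v $ 1, S / s * v $ 2, v $ 3 + \<alpha> * s\<^sup>2 * v $ 4, (r\<^sup>2 - \<alpha>\<^sup>2) * v $ 4 - \<alpha> * v $ 3])"

lemma linear_kerr_coframe: "linear (kerr_coframe M \<alpha> p)"
  unfolding kerr_coframe_def Let_def
  by (intro linearI; unfold vec_eq_iff forall_4;
      simp add: algebra_simps add_divide_distrib diff_divide_distrib)

text \<open>
  On the planes spanned by the components 1, 3 and 2, 4 the metric is conformal to the Euclidean one,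
  which yields its positivity and its compatibility with the two complex structures.
\<close>

lemma kerr_metric_coframe:
  assumes p: "p \<in> kerr_region M \<alpha>"
  shows "kerr_metric M \<alpha> p v w =
     (let f = kerr_coframe M \<alpha> p v; f' = kerr_coframe M \<alpha> p w in
      kerr_Delta M \<alpha> p / kerr_Sigma \<alpha> p * (f $ 1 * f' $ 1 + f $ 3 * f' $ 3)
      + (sin (p $ 2))\<^sup>2 / kerr_Sigma \<alpha> p * (f $ 2 * f' $ 2 + f $ 4 * f' $ 4))"
  using kerr_region_nonzero[OF p]
  by (simp add: kerr_metric_def kerr_coframe_def Let_def field_simps power2_eq_square)

text \<open>
  The last two components are linear forms in \<open>dt\<close>, \<open>d\<phi>\<close> with determinant \<Sigma>.
\<close>

lemma kerr_coframe_inj: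
  assumes p: "p \<in> kerr_region M \<alpha>" and "kerr_coframe M \<alpha> p v = 0"
  shows "v = 0"
proof -
  have S: "kerr_Sigma \<alpha> p = (p $ 1)\<^sup>2 - \<alpha>\<^sup>2 + \<alpha>\<^sup>2 * (sin (p $ 2))\<^sup>2"
    by (simp add: kerr_Sigma_def sin_squared_eq algebra_simps)
  have z: "v $ 1 = 0" "v $ 2 = 0" "v $ 3 + \<alpha> * (sin (p $ 2))\<^sup>2 * v $ 4 = 0"
     "((p $ 1)\<^sup>2 - \<alpha>\<^sup>2) * v $ 4 - \<alpha> * v $ 3 = 0"
    using assms(2) kerr_region_nonzero[OF p]
    unfolding vec_eq_iff forall_4 kerr_coframe_def Let_def vector_4 by auto
  then have "kerr_Sigma \<alpha> p * v $ 4 = 0" "kerr_Sigma \<alpha> p * v $ 3 = 0"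
    unfolding S by algebra+
  then show ?thesis
    using z kerr_region_nonzero[OF p] by (simp add: vec_eq_iff forall_4)
qed

lemma kerr_metric_pos:
  assumes p: "p \<in> kerr_region M \<alpha>" and "v \<noteq> 0"
  shows "kerr_metric M \<alpha> p v v > 0"
proof -
  define f where "f = kerr_coframe M \<alpha> p v"
  have "f \<noteq> 0" using kerr_coframe_inj[OF p, of v] assms(2) by (auto simp: f_def)
  then have *: "f $ 1 \<noteq> 0 \<or> f $ 3 \<noteq> 0 \<or> f $ 2 \<noteq> 0 \<or> f $ 4 \<noteq> 0"
    by (auto simp: vec_eq_iff forall_4)
  define a b where "a = kerr_Delta M \<alpha> p / kerr_Sigma \<alpha> p" and "b = (sin (p $ 2))\<^sup>2 / kerr_Sigma \<alpha> p"
  have ab: "a > 0" "b > 0"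
    using p kerr_region_nonzero[OF p] by (auto simp: kerr_region_def a_def b_def)
  have "a * ((f $ 1)\<^sup>2 + (f $ 3)\<^sup>2) \<ge> 0" "b * ((f $ 2)\<^sup>2 + (f $ 4)\<^sup>2) \<ge> 0"
    using ab by simp_all
  moreover have "a * ((f $ 1)\<^sup>2 + (f $ 3)\<^sup>2) > 0 \<or> b * ((f $ 2)\<^sup>2 + (f $ 4)\<^sup>2) > 0"
    using ab * by (metis mult_pos_pos sum_power2_gt_zero_iff)
  moreover have "kerr_metric M \<alpha> p v v = a * ((f $ 1)\<^sup>2 + (f $ 3)\<^sup>2) + b * ((f $ 2)\<^sup>2 + (f $ 4)\<^sup>2)"
    by (simp add: kerr_metric_coframe[OF p] Let_def f_def a_def b_def power2_eq_square)
  ultimately show ?thesis by linarith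
qed

section \<open>The Levi-Civita connection and Ricci curvature\<close>

definition kerr_matrix :: "real \<Rightarrow> real \<Rightarrow> pt \<Rightarrow> real ^ 4 ^ 4" where
  "kerr_matrix M \<alpha> p =
     (let r = p $ 1; s = sin (p $ 2); S = kerr_Sigma \<alpha> p; D = kerr_Delta M \<alpha> p; \<rho> = r\<^sup>2 - \<alpha>\<^sup>2;
          m = \<alpha> * s\<^sup>2 * (D - \<rho>) / S
      in vector [vector [S / D, 0, 0, 0],
                 vector [0, S, 0, 0],
                 vector [0, 0, (D + \<alpha>\<^sup>2 * s\<^sup>2) / S, m],
                 vector [0, 0, m, s\<^sup>2 * (\<alpha>\<^sup>2 * s\<^sup>2 * D + \<rho>\<^sup>2) / S]])"

lemma metric_matrix_kerr: "metric_matrix (kerr_metric M \<alpha>) = kerr_matrix M \<alpha>"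
proof
  fix p
  show "metric_matrix (kerr_metric M \<alpha>) p = kerr_matrix M \<alpha> p"
    unfolding vec_eq_iff forall_4 metric_matrix_def kerr_matrix_def kerr_metric_def
    by (simp add: axis_def Let_def) (simp add: divide_inverse algebra_simps power2_eq_square)
qed

text \<open>
  The matrices of partial derivatives of the metric, indexed by the direction of differentiation.
  They use the form 1 - 2 M r / \<Sigma> of the coefficient of \<open>dt^2\<close> and its analogues, in which the
  numerators no longer contain \<Delta>.
\<close>

definition kerr_matrix_deriv :: "real \<Rightarrow> real \<Rightarrow> pt \<Rightarrow> 4 \<Rightarrow> real ^ 4 ^ 4" where
  "kerr_matrix_deriv M \<alpha> p =
     (let r = p $ 1; s = sin (p $ 2); c = cos (p $ 2); S = kerr_Sigma \<alpha> p; D = kerr_Delta M \<alpha> p;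
          u = r\<^sup>2 + \<alpha>\<^sup>2 * c\<^sup>2; \<rho> = r\<^sup>2 - \<alpha>\<^sup>2;
          hr = 2 * M * u / S\<^sup>2; ht = 4 * M * r * \<alpha> * c * s / S\<^sup>2
      in ($) (vector
        [vector [vector [2 * r / D - 2 * S * (r - M) / D\<^sup>2, 0, 0, 0],
                 vector [0, 2 * r, 0, 0],
                 vector [0, 0, hr, \<alpha> * s\<^sup>2 * hr],
                 vector [0, 0, \<alpha> * s\<^sup>2 * hr, s\<^sup>2 * (2 * r + \<alpha>\<^sup>2 * s\<^sup>2 * hr)]],
         vector [vector [2 * \<alpha>\<^sup>2 * c * s / D, 0, 0, 0],
                 vector [0, 2 * \<alpha>\<^sup>2 * c * s, 0, 0],
                 vector [0, 0, \<alpha> * ht, - \<rho> * ht],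
                 vector [0, 0, - \<rho> * ht, 2 * s * c * (\<rho> - 2 * M * r * \<alpha>\<^sup>2 * s\<^sup>2 * (S + \<rho>) / S\<^sup>2)]],
         0, 0]))"

text \<open>
  The quotient rule produces unsimplified expressions; comparison with the stated derivatives is an
  identity of rational functions.
\<close>

lemma grad2_kerr_matrix:
  assumes p: "p \<in> kerr_region M \<alpha>"
  shows "grad2 (\<lambda>q. kerr_matrix M \<alpha> q $ j $ l) p
     (kerr_matrix_deriv M \<alpha> p 1 $ j $ l) (kerr_matrix_deriv M \<alpha> p 2 $ j $ l)"
proof -
  note nz = kerr_region_nonzero[OF p]
  note rel = kerr_relations(1)[of \<alpha> p] kerr_relations(2)[of M \<alpha> p] kerr_relations(3)[of p]
  have "\<forall>j l. grad2 (\<lambda>q. kerr_matrix M \<alpha> q $ j $ l) p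
     (kerr_matrix_deriv M \<alpha> p 1 $ j $ l) (kerr_matrix_deriv M \<alpha> p 2 $ j $ l)"
    unfolding forall_4 kerr_matrix_def kerr_matrix_deriv_def Let_def vector_4
    by (intro conjI; (rule grad2_cong, (rule grad2_intros nz power_not_zero)+))
      (simp_all add: divide_simps nz, (use rel in algebra)+)
  then show ?thesis by blast
qed

lemma partial_kerr_matrix:
  assumes p: "p \<in> kerr_region M \<alpha>"
  shows "partial i (\<lambda>q. kerr_matrix M \<alpha> q $ j $ l) p = kerr_matrix_deriv M \<alpha> p i $ j $ l"
proof -
  have "kerr_matrix_deriv M \<alpha> p 3 = 0" "kerr_matrix_deriv M \<alpha> p 4 = 0"
    by (simp_all add: kerr_matrix_deriv_def Let_def)
  with grad2_partial[OF grad2_kerr_matrix[OF p]] exhaust_4[of i] show ?thesis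
    by auto
qed

text \<open>
  The matrix of the bilinear form sends \<open>x\<close> to the components of \<open>g(\<cdot>, x)\<close>, so a vector in
  its kernel has \<open>g(x, x) = 0\<close>.
\<close>

lemma metric_matrix_invertible:
  assumes "bilinear (g p)" and pos: "\<And>v. v \<noteq> 0 \<Longrightarrow> g p v v > 0"
  shows "invertible (metric_matrix g p)"
proof -
  have lin: "linear (g p v)" "linear (\<lambda>v. g p v w)" for v w
    using assms(1) by (simp_all add: bilinear_def)
  have row: "(metric_matrix g p *v x) $ i = g p (axis i 1) x" for x i
  proof -
    have "g p (axis i 1) x = g p (axis i 1) (\<Sum>j\<in>UNIV. x $ j *\<^sub>R axis j 1)"
      using basis_expansion[of x] by (simp add: scalar_mult_eq_scaleR)
    then show ?thesis
      by (simp add: linear_sum[OF lin(1)] linear_scale[OF lin(1)] metric_matrix_def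
          matrix_vector_mult_def mult_ac)
  qed
  have "x = 0" if "metric_matrix g p *v x = 0" for x
  proof (rule ccontr)
    assume "x \<noteq> 0"
    have "g p x x = g p (\<Sum>i\<in>UNIV. x $ i *\<^sub>R axis i 1) x"
      using basis_expansion[of x] by (simp add: scalar_mult_eq_scaleR)
    also have "\<dots> = (\<Sum>i\<in>UNIV. x $ i * g p (axis i 1) x)"
      by (simp add: linear_sum[OF lin(2)] linear_scale[OF lin(2)])
    also have "\<dots> = 0"
      using that row[of x] by simp
    finally show False using pos[OF \<open>x \<noteq> 0\<close>] by simp
  qed
  then show ?thesis
    by (simp add: invertible_left_inverse matrix_left_invertible_ker)
qed

text \<open>
  Connection coefficients can be verified without inverting the metric: it suffices that lowering the
  upper index gives the coefficients of the first kind.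
\<close>

lemma christoffel_eqI:
  assumes inv: "invertible (metric_matrix g p)"
    and eq: "\<And>l. 2 * (\<Sum>k\<in>UNIV. metric_matrix g p $ l $ k * C $ k) =
      partial i (\<lambda>q. metric_matrix g q $ j $ l) p + partial j (\<lambda>q. metric_matrix g q $ i $ l) p
      - partial l (\<lambda>q. metric_matrix g q $ i $ j) p"
  shows "christoffel g k i j p = C $ k"
proof -
  let ?G = "metric_matrix g p"
  let ?L = "\<chi> l. partial i (\<lambda>q. metric_matrix g q $ j $ l) p + partial j (\<lambda>q. metric_matrix g q $ i $ l) p
      - partial l (\<lambda>q. metric_matrix g q $ i $ j) p"
  have "?G *v (2 *\<^sub>R C) = ?L"
    using eq by (simp add: vec_eq_iff matrix_vector_mult_def sum_distrib_left mult_ac)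
  then have "matrix_inv ?G *v ?L = (matrix_inv ?G ** ?G) *v (2 *\<^sub>R C)"
    by (simp flip: matrix_vector_mul_assoc)
  also have "\<dots> = 2 *\<^sub>R C"
    using someI_ex[OF inv[unfolded invertible_def]] by (simp add: matrix_inv_def)
  finally have "(matrix_inv ?G *v ?L) $ k / 2 = C $ k" by simp
  then show ?thesis
    by (simp add: christoffel_def matrix_vector_mult_def)
qed

text \<open>
  The connection coefficients, with the upper index first. As the metric is block diagonal and
  independent of \<open>t\<close> and \<open>\<phi>\<close>, a coefficient vanishes unless an even number of its indices
  belongs to these two coordinates. The local names such as \<open>tfr\<close> list the upper index and then the
  lower ones, with \<open>f\<close> for \<open>\<phi>\<close>.
\<close>

definition kerr_Gamma :: "real \<Rightarrow> real \<Rightarrow> pt \<Rightarrow> 4 \<Rightarrow> real ^ 4 ^ 4" where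
  "kerr_Gamma M \<alpha> p =
     (let r = p $ 1; s = sin (p $ 2); c = cos (p $ 2); S = kerr_Sigma \<alpha> p; D = kerr_Delta M \<alpha> p;
          u = r\<^sup>2 + \<alpha>\<^sup>2 * c\<^sup>2; \<rho> = r\<^sup>2 - \<alpha>\<^sup>2;
          e = \<alpha>\<^sup>2 * c * s / S;
          ttr = M * \<rho> * u / (S\<^sup>2 * D);
          tt\<theta> = 2 * M * r * \<alpha>\<^sup>2 * s * c / S\<^sup>2;
          ftr = M * \<alpha> * u / (S\<^sup>2 * D);
          ft\<theta> = - 2 * M * r * \<alpha> * c / (s * S\<^sup>2);
          tfr = - M * \<alpha> * s\<^sup>2 * (\<alpha>\<^sup>2 * c\<^sup>2 * (\<alpha>\<^sup>2 + r\<^sup>2) + r\<^sup>2 * \<alpha>\<^sup>2 - 3 * r ^ 4) / (S\<^sup>2 * D);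
          tf\<theta> = 2 * M * r * \<alpha> ^ 3 * s ^ 3 * c / S\<^sup>2;
          ffr = (r * S\<^sup>2 + M * (\<alpha> ^ 4 * s\<^sup>2 * c\<^sup>2 - r\<^sup>2 * (S + \<rho>))) / (S\<^sup>2 * D);
          ff\<theta> = c * (S\<^sup>2 - 2 * M * r * \<alpha>\<^sup>2 * s\<^sup>2) / (s * S\<^sup>2);
          rtt = - M * D * u / S ^ 3; rtf = - M * D * \<alpha> * s\<^sup>2 * u / S ^ 3;
          \<theta>tf = 2 * M * r * \<alpha> * s * c * \<rho> / S ^ 3
      in ($) (vector
        [vector [vector [r / S - (r - M) / D, e, 0, 0],
                 vector [e, - r * D / S, 0, 0],
                 vector [0, 0, rtt, rtf],
                 vector [0, 0, rtf, - (D * s\<^sup>2 / S) * (r + M * \<alpha>\<^sup>2 * s\<^sup>2 * u / S\<^sup>2)]],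
         vector [vector [- e / D, r / S, 0, 0],
                 vector [r / S, e, 0, 0],
                 vector [0, 0, - 2 * M * r * \<alpha>\<^sup>2 * c * s / S ^ 3, \<theta>tf],
                 vector [0, 0, \<theta>tf, - (s * c / S) * (\<rho> - 2 * M * r * \<alpha>\<^sup>2 * s\<^sup>2 * (S + \<rho>) / S\<^sup>2)]],
         vector [vector [0, 0, ttr, tfr],
                 vector [0, 0, tt\<theta>, tf\<theta>],
                 vector [ttr, tt\<theta>, 0, 0],
                 vector [tfr, tf\<theta>, 0, 0]],
         vector [vector [0, 0, ftr, ffr],
                 vector [0, 0, ft\<theta>, ff\<theta>],
                 vector [ftr, ft\<theta>, 0, 0],
                 vector [ffr, ff\<theta>, 0, 0]]]))"

lemma kerr_Gamma_sym: "kerr_Gamma M \<alpha> p k $ i $ j = kerr_Gamma M \<alpha> p k $ j $ i"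
proof -
  have "\<forall>k i j. kerr_Gamma M \<alpha> p k $ i $ j = kerr_Gamma M \<alpha> p k $ j $ i"
    unfolding forall_4 kerr_Gamma_def Let_def vector_4 by simp
  then show ?thesis by blast
qed

lemma kerr_Gamma_lowered:
  assumes p: "p \<in> kerr_region M \<alpha>"
  shows "2 * (\<Sum>k\<in>UNIV. kerr_matrix M \<alpha> p $ l $ k * kerr_Gamma M \<alpha> p k $ i $ j) =
    kerr_matrix_deriv M \<alpha> p i $ j $ l + kerr_matrix_deriv M \<alpha> p j $ i $ l - kerr_matrix_deriv M \<alpha> p l $ i $ j"
proof -
  note nz = kerr_region_nonzero[OF p]
  note rel = kerr_relations(1)[of \<alpha> p] kerr_relations(2)[of M \<alpha> p] kerr_relations(3)[of p]
  have "\<forall>l i j. 2 * (\<Sum>k\<in>UNIV. kerr_matrix M \<alpha> p $ l $ k * kerr_Gamma M \<alpha> p k $ i $ j) =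
    kerr_matrix_deriv M \<alpha> p i $ j $ l + kerr_matrix_deriv M \<alpha> p j $ i $ l - kerr_matrix_deriv M \<alpha> p l $ i $ j"
    unfolding forall_4 sum_4 kerr_matrix_def kerr_Gamma_def kerr_matrix_deriv_def Let_def vector_4 zero_index
    by (intro conjI; (simp add: divide_simps nz)?; (algebra | (use rel in algebra))?)
  then show ?thesis by blast
qed

lemma christoffel_kerr:
  assumes p: "p \<in> kerr_region M \<alpha>"
  shows "christoffel (kerr_metric M \<alpha>) k i j p = kerr_Gamma M \<alpha> p k $ i $ j"
proof -
  let ?C = "\<chi> k. kerr_Gamma M \<alpha> p k $ i $ j"
  have "christoffel (kerr_metric M \<alpha>) k i j p = ?C $ k"
  proof (rule christoffel_eqI)
    show "invertible (metric_matrix (kerr_metric M \<alpha>) p)"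
      using metric_matrix_invertible kerr_metric_bilinear kerr_metric_pos[OF p] by blast
  qed (use kerr_Gamma_lowered[OF p] in \<open>simp add: metric_matrix_kerr partial_kerr_matrix[OF p]\<close>)
  then show ?thesis by simp
qed

text \<open>
  The partial derivative of the coefficients with upper index \<open>k\<close> in the direction \<open>k\<close>. Only these
  and the derivatives of the contraction enter the Ricci tensor.
\<close>

definition kerr_dGamma :: "real \<Rightarrow> real \<Rightarrow> pt \<Rightarrow> 4 \<Rightarrow> real ^ 4 ^ 4" where
  "kerr_dGamma M \<alpha> p =
     (let r = p $ 1; s = sin (p $ 2); c = cos (p $ 2); S = kerr_Sigma \<alpha> p; D = kerr_Delta M \<alpha> p;
          u = r\<^sup>2 + \<alpha>\<^sup>2 * c\<^sup>2; \<rho> = r\<^sup>2 - \<alpha>\<^sup>2;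
          d = (c\<^sup>2 - s\<^sup>2) / S - 2 * \<alpha>\<^sup>2 * c\<^sup>2 * s\<^sup>2 / S\<^sup>2;
          d' = (c\<^sup>2 - s\<^sup>2) / S ^ 3 - 6 * \<alpha>\<^sup>2 * c\<^sup>2 * s\<^sup>2 / S ^ 4;
          a = - 2 * r * \<alpha>\<^sup>2 * c * s / S\<^sup>2;
          b = - 2 * M * ((r - M) * u + r * D) / S ^ 3 + 6 * r * M * D * u / S ^ 4
      in ($) (vector
        [vector [vector [1 / S - 2 * r\<^sup>2 / S\<^sup>2 - 1 / D + 2 * (r - M)\<^sup>2 / D\<^sup>2, a, 0, 0],
                 vector [a, - D / S - 2 * r * (r - M) / S + 2 * r\<^sup>2 * D / S\<^sup>2, 0, 0],
                 vector [0, 0, b, \<alpha> * s\<^sup>2 * b],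
                 vector [0, 0, \<alpha> * s\<^sup>2 * b,
                   - s\<^sup>2 * ((2 * (r - M) / S - 2 * r * D / S\<^sup>2) * (r + M * \<alpha>\<^sup>2 * s\<^sup>2 * u / S\<^sup>2)
                    + D / S * (1 + M * \<alpha>\<^sup>2 * s\<^sup>2 * (2 * r / S\<^sup>2 - 4 * r * u / S ^ 3)))]],
         vector [vector [- \<alpha>\<^sup>2 * d / D, a, 0, 0],
                 vector [a, \<alpha>\<^sup>2 * d, 0, 0],
                 vector [0, 0, - 2 * M * r * \<alpha>\<^sup>2 * d', 2 * M * r * \<alpha> * \<rho> * d'],
                 vector [0, 0, 2 * M * r * \<alpha> * \<rho> * d',
                   - d * (\<rho> - 2 * M * r * \<alpha>\<^sup>2 * s\<^sup>2 * (S + \<rho>) / S\<^sup>2)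
                   + (s * c / S) * (2 * M * r * \<alpha>\<^sup>2) *
                     (2 * s * c * (S + \<rho>) / S\<^sup>2 + 2 * \<alpha>\<^sup>2 * c * s ^ 3 / S\<^sup>2 - 4 * \<alpha>\<^sup>2 * c * s ^ 3 * (S + \<rho>) / S ^ 3)]],
         0, 0]))"

lemma partial_kerr_Gamma:
  assumes p: "p \<in> kerr_region M \<alpha>"
  shows "partial k (\<lambda>q. kerr_Gamma M \<alpha> q k $ i $ j) p = kerr_dGamma M \<alpha> p k $ i $ j"
proof -
  note nz = kerr_region_nonzero[OF p]
  note rel = kerr_relations(1)[of \<alpha> p] kerr_relations(2)[of M \<alpha> p] kerr_relations(3)[of p]
  have "\<forall>k i j. partial k (\<lambda>q. kerr_Gamma M \<alpha> q k $ i $ j) p = kerr_dGamma M \<alpha> p k $ i $ j"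
    unfolding forall_4 kerr_Gamma_def kerr_dGamma_def Let_def vector_4 zero_index
    by (intro conjI)
      ((rule partial_eqI, (rule grad2_intros nz power_not_zero no_zero_divisors)+,
        ((simp add: divide_simps nz)?; (algebra | (use rel in algebra))?))
      | (rule grad2_partial(3-4), (rule grad2_intros nz power_not_zero no_zero_divisors)+))+
  then show ?thesis by blast
qed

text \<open>
  The derivatives of the other coefficients enter only through the contraction, so that their existence
  suffices to exchange sums and derivatives.
\<close>

lemma grad2_kerr_Gamma:
  assumes p: "p \<in> kerr_region M \<alpha>"
  shows "\<exists>a b. grad2 (\<lambda>q. kerr_Gamma M \<alpha> q k $ i $ j) p a b"
proof -
  note nz = kerr_region_nonzero[OF p]
  have "\<forall>k i j. \<exists>a b. grad2 (\<lambda>q. kerr_Gamma M \<alpha> q k $ i $ j) p a b"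
    unfolding forall_4 kerr_Gamma_def Let_def vector_4 zero_index
    by (intro conjI exI; (rule grad2_intros nz power_not_zero no_zero_divisors)+)
  then show ?thesis by blast
qed

text \<open>
  The differential of log (\<Sigma> sin \<theta>), where \<Sigma> sin \<theta> is the square root of the determinant of the metric.
\<close>

definition kerr_log_vol :: "real \<Rightarrow> pt \<Rightarrow> real ^ 4" where
  "kerr_log_vol \<alpha> p = (let r = p $ 1; s = sin (p $ 2); c = cos (p $ 2); S = kerr_Sigma \<alpha> p in
     vector [2 * r / S, 2 * \<alpha>\<^sup>2 * c * s / S + c / s, 0, 0])"

definition kerr_log_vol_hess :: "real \<Rightarrow> pt \<Rightarrow> real ^ 4 ^ 4" where
  "kerr_log_vol_hess \<alpha> p = (let r = p $ 1; s = sin (p $ 2); c = cos (p $ 2); S = kerr_Sigma \<alpha> p;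
       m = - 4 * r * \<alpha>\<^sup>2 * c * s / S\<^sup>2 in
     vector [vector [2 / S - 4 * r\<^sup>2 / S\<^sup>2, m, 0, 0],
       vector [m, 2 * \<alpha>\<^sup>2 * (c\<^sup>2 - s\<^sup>2) / S - 4 * \<alpha> ^ 4 * c\<^sup>2 * s\<^sup>2 / S\<^sup>2 - 1 / s\<^sup>2, 0, 0],
       0, 0])"

text \<open>
  This is the general identity expressing the contracted connection through the volume density.
\<close>

lemma kerr_Gamma_trace:
  assumes p: "p \<in> kerr_region M \<alpha>"
  shows "(\<Sum>k\<in>UNIV. kerr_Gamma M \<alpha> p k $ i $ k) = kerr_log_vol \<alpha> p $ i"
proof -
  note nz = kerr_region_nonzero[OF p]
  note rel = kerr_relations(1)[of \<alpha> p] kerr_relations(2)[of M \<alpha> p] kerr_relations(3)[of p]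
  have "\<forall>i. (\<Sum>k\<in>UNIV. kerr_Gamma M \<alpha> p k $ i $ k) = kerr_log_vol \<alpha> p $ i"
    unfolding forall_4 sum_4 kerr_Gamma_def kerr_log_vol_def Let_def vector_4 zero_index
    by (intro conjI; (simp add: divide_simps nz)?; (algebra | (use rel in algebra))?)
  then show ?thesis by blast
qed

lemma partial_kerr_log_vol:
  assumes p: "p \<in> kerr_region M \<alpha>"
  shows "partial j (\<lambda>q. kerr_log_vol \<alpha> q $ i) p = kerr_log_vol_hess \<alpha> p $ i $ j"
proof -
  note nz = kerr_region_nonzero[OF p]
  note rel = kerr_relations(1)[of \<alpha> p] kerr_relations(2)[of M \<alpha> p] kerr_relations(3)[of p]
  have "\<forall>j i. partial j (\<lambda>q. kerr_log_vol \<alpha> q $ i) p = kerr_log_vol_hess \<alpha> p $ i $ j"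
    unfolding forall_4 kerr_log_vol_def kerr_log_vol_hess_def Let_def vector_4 zero_index
    by (intro conjI)
      ((rule partial_eqI, (rule grad2_intros nz power_not_zero no_zero_divisors)+,
        ((simp add: divide_simps nz)?; (algebra | (use rel in algebra))?))
      | (rule grad2_partial(3-4), (rule grad2_intros nz power_not_zero no_zero_divisors)+))+
  then show ?thesis by blast
qed

text \<open>
  The Ricci tensor, written with the contraction \<open>kerr_log_vol\<close> of the connection. After clearing
  denominators every component lies in the ideal generated by \<open>kerr_relations\<close>.
\<close>

lemma kerr_ricci_identity:
  assumes p: "p \<in> kerr_region M \<alpha>"
  shows "(\<Sum>k\<in>UNIV. kerr_dGamma M \<alpha> p k $ i $ j) - kerr_log_vol_hess \<alpha> p $ i $ j
     + (\<Sum>l\<in>UNIV. kerr_log_vol \<alpha> p $ l * kerr_Gamma M \<alpha> p l $ i $ j)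
     - (\<Sum>k\<in>UNIV. \<Sum>l\<in>UNIV. kerr_Gamma M \<alpha> p k $ j $ l * kerr_Gamma M \<alpha> p l $ i $ k) = 0"
proof -
  note nz = kerr_region_nonzero[OF p]
  note rel = kerr_relations(1)[of \<alpha> p] kerr_relations(2)[of M \<alpha> p] kerr_relations(3)[of p]
  have "\<forall>i j. (\<Sum>k\<in>UNIV. kerr_dGamma M \<alpha> p k $ i $ j) - kerr_log_vol_hess \<alpha> p $ i $ j
     + (\<Sum>l\<in>UNIV. kerr_log_vol \<alpha> p $ l * kerr_Gamma M \<alpha> p l $ i $ j)
     - (\<Sum>k\<in>UNIV. \<Sum>l\<in>UNIV. kerr_Gamma M \<alpha> p k $ j $ l * kerr_Gamma M \<alpha> p l $ i $ k) = 0"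
    unfolding forall_4 sum_4 kerr_Gamma_def kerr_dGamma_def kerr_log_vol_def kerr_log_vol_hess_def Let_def vector_4 zero_index
    by (intro conjI; (simp add: divide_simps nz)?; (algebra | (use rel in algebra))?)
  then show ?thesis by blast
qed

lemma ricci_flat_kerr: "ricci_flat (kerr_region M \<alpha>) (kerr_metric M \<alpha>)"
  unfolding ricci_flat_def
proof (intro ballI allI)
  fix p i j
  assume p: "p \<in> kerr_region M \<alpha>"
  note cong = partial_cong[OF open_kerr_region p]
  have d: "partial m (christoffel (kerr_metric M \<alpha>) k i j) p
     = partial m (\<lambda>q. kerr_Gamma M \<alpha> q k $ i $ j) p" for m k i j
    by (intro cong christoffel_kerr)
  have "(\<Sum>k\<in>UNIV. partial j (\<lambda>q. kerr_Gamma M \<alpha> q k $ i $ k) p)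
      = partial j (\<lambda>q. \<Sum>k\<in>UNIV. kerr_Gamma M \<alpha> q k $ i $ k) p"
    using grad2_kerr_Gamma[OF p] by (intro partial_sum) blast
  also have "\<dots> = partial j (\<lambda>q. kerr_log_vol \<alpha> q $ i) p"
    by (intro cong kerr_Gamma_trace)
  finally have T: "(\<Sum>k\<in>UNIV. partial j (\<lambda>q. kerr_Gamma M \<alpha> q k $ i $ k) p)
      = kerr_log_vol_hess \<alpha> p $ i $ j"
    by (simp add: partial_kerr_log_vol[OF p])
  have V: "(\<Sum>k\<in>UNIV. \<Sum>l\<in>UNIV. kerr_Gamma M \<alpha> p k $ k $ l * kerr_Gamma M \<alpha> p l $ i $ j)
     = (\<Sum>l\<in>UNIV. kerr_log_vol \<alpha> p $ l * kerr_Gamma M \<alpha> p l $ i $ j)"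
    unfolding kerr_Gamma_trace[OF p, symmetric] sum_distrib_right
    by (subst sum.swap) (intro sum.cong refl arg_cong2[where f = "(*)"] kerr_Gamma_sym)
  show "ricci (kerr_metric M \<alpha>) i j p = 0"
    using kerr_ricci_identity[OF p, of i j]
    by (simp add: ricci_def d christoffel_kerr[OF p] sum_subtractf T V partial_kerr_Gamma[OF p])
qed

section \<open>The two complex structures\<close>

text \<open>
  The sign \<open>\<epsilon>\<close> distinguishes the two complex structures. Both send \<partial>_r to the same multiple of the
  vector in the plane of \<partial>_t and \<partial>_\<phi> annihilated by \<tau>; the image of \<partial>_\<theta>, a multiple of the
  vector annihilated by \<sigma>, changes sign with \<open>\<epsilon>\<close>.
\<close>

definition kerr_J :: "real \<Rightarrow> real \<Rightarrow> real \<Rightarrow> endo" where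
  "kerr_J M \<alpha> \<epsilon> p v =
     (let r = p $ 1; s = sin (p $ 2); S = kerr_Sigma \<alpha> p; D = kerr_Delta M \<alpha> p; \<rho> = r\<^sup>2 - \<alpha>\<^sup>2;
          \<sigma> = v $ 3 + \<alpha> * s\<^sup>2 * v $ 4; \<tau> = \<rho> * v $ 4 - \<alpha> * v $ 3 in
      vector [- (D / S * \<sigma>), - (\<epsilon> * s / S * \<tau>), \<rho> / D * v $ 1 - \<epsilon> * \<alpha> * s * v $ 2,
        \<alpha> / D * v $ 1 + \<epsilon> / s * v $ 2])"

definition model_J :: "real \<Rightarrow> pt \<Rightarrow> pt" where
  "model_J \<epsilon> f = vector [- f $ 3, - \<epsilon> * f $ 4, f $ 1, \<epsilon> * f $ 2]"

lemma kerr_coframe_J: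
  assumes p: "p \<in> kerr_region M \<alpha>"
  shows "kerr_coframe M \<alpha> p (kerr_J M \<alpha> \<epsilon> p v) = model_J \<epsilon> (kerr_coframe M \<alpha> p v)"
proof -
  note nz = kerr_region_nonzero[OF p]
  note rel = kerr_relations(1)[of \<alpha> p] kerr_relations(3)[of p]
  show ?thesis
    unfolding vec_eq_iff forall_4 kerr_coframe_def kerr_J_def model_J_def Let_def vector_4
    by (intro conjI; (simp add: divide_simps nz)?; (algebra | (use rel in algebra))?)
qed

lemma linear_kerr_J: "linear (kerr_J M \<alpha> \<epsilon> p)"
  unfolding kerr_J_def Let_def
  by (intro linearI; unfold vec_eq_iff forall_4;
      simp add: algebra_simps add_divide_distrib diff_divide_distrib)

lemma smooth_on_kerr_J: "smooth_on (kerr_region M \<alpha>) (\<lambda>p. kerr_J M \<alpha> \<epsilon> p v)"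
proof (rule smooth_on_vecI[OF open_kerr_region])
  fix i
  have "\<forall>i. smooth_on (kerr_region M \<alpha>) (\<lambda>p. kerr_J M \<alpha> \<epsilon> p v $ i)"
    unfolding forall_4 kerr_J_def Let_def vector_4
    by (intro conjI smooth_intros open_kerr_region smooth_on_kerr_Sigma smooth_on_kerr_Delta
        kerr_region_nonzero)
  then show "smooth_on (kerr_region M \<alpha>) (\<lambda>p. kerr_J M \<alpha> \<epsilon> p v $ i)" by blast
qed

lemma kerr_J_square:
  assumes p: "p \<in> kerr_region M \<alpha>" and "\<epsilon>\<^sup>2 = 1"
  shows "kerr_J M \<alpha> \<epsilon> p (kerr_J M \<alpha> \<epsilon> p v) = - v"
proof -
  let ?F = "kerr_coframe M \<alpha> p" and ?J = "kerr_J M \<alpha> \<epsilon> p"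
  have "?F (?J (?J v) + v) = model_J \<epsilon> (model_J \<epsilon> (?F v)) + ?F v"
    by (simp add: linear_add[OF linear_kerr_coframe] kerr_coframe_J[OF p])
  also have "\<dots> = 0"
    using assms(2) by (simp add: model_J_def vec_eq_iff forall_4 power2_eq_square flip: mult.assoc)
  finally show ?thesis
    using kerr_coframe_inj[OF p] eq_neg_iff_add_eq_0 by blast
qed

lemma kerr_metric_J:
  assumes p: "p \<in> kerr_region M \<alpha>" and "\<epsilon>\<^sup>2 = 1"
  shows "kerr_metric M \<alpha> p (kerr_J M \<alpha> \<epsilon> p v) (kerr_J M \<alpha> \<epsilon> p w) = kerr_metric M \<alpha> p v w"
proof -
  have e: "\<epsilon> * x * (\<epsilon> * y) = x * y" for x y
    using assms(2) by algebra
  show ?thesis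
    unfolding kerr_metric_coframe[OF p] kerr_coframe_J[OF p] model_J_def Let_def vector_4
    using assms(2) by (simp only: minus_mult_minus mult_minus_left e) (simp add: add.commute power2_eq_square)
qed

lemma det_4:
  "det (A :: 'a::comm_ring_1 ^ 4 ^ 4) =
     A$1$1 * (A$2$2*A$3$3*A$4$4 + A$2$3*A$3$4*A$4$2 + A$2$4*A$3$2*A$4$3
            - A$2$2*A$3$4*A$4$3 - A$2$3*A$3$2*A$4$4 - A$2$4*A$3$3*A$4$2)
   - A$1$2 * (A$2$1*A$3$3*A$4$4 + A$2$3*A$3$4*A$4$1 + A$2$4*A$3$1*A$4$3
            - A$2$1*A$3$4*A$4$3 - A$2$3*A$3$1*A$4$4 - A$2$4*A$3$3*A$4$1)
   + A$1$3 * (A$2$1*A$3$2*A$4$4 + A$2$2*A$3$4*A$4$1 + A$2$4*A$3$1*A$4$2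
            - A$2$1*A$3$4*A$4$2 - A$2$2*A$3$1*A$4$4 - A$2$4*A$3$2*A$4$1)
   - A$1$4 * (A$2$1*A$3$2*A$4$3 + A$2$2*A$3$3*A$4$1 + A$2$3*A$3$1*A$4$2
            - A$2$1*A$3$3*A$4$2 - A$2$2*A$3$1*A$4$3 - A$2$3*A$3$2*A$4$1)"
proof -
  have f: "finite {2::4, 3, 4}" "1 \<notin> {2::4, 3, 4}" "finite {3::4, 4}" "2 \<notin> {3::4, 4}"
    "finite {4::4}" "3 \<notin> {4::4}"
    by auto
  show ?thesis
    unfolding det_def UNIV_4
    unfolding sum_over_permutations_insert[OF f(1,2)]
    unfolding sum_over_permutations_insert[OF f(3,4)]
    unfolding sum_over_permutations_insert[OF f(5,6)]
    unfolding permutes_sing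
    by (simp add: sign_swap_id permutation_swap_id sign_compose sign_id swap_id_eq permutation_compose)
      (simp add: algebra_simps)
qed

text \<open>
  In the complex coordinates f1 + i f3 and f2 + i \<epsilon> f4, for which the model is multiplication by i, the
  determinant is the squared modulus of the complex 2 x 2 determinant of the two vectors. The sign
  comes from reordering the real coordinates and from orienting f4 by \<epsilon>.
\<close>

lemma det_model_J:
  assumes "\<epsilon>\<^sup>2 = 1"
  shows "det (vector [f, model_J \<epsilon> f, h, model_J \<epsilon> h] :: real ^ 4 ^ 4) =
    - \<epsilon> * ((f $ 1 * h $ 2 - \<epsilon> * f $ 3 * h $ 4 - h $ 1 * f $ 2 + \<epsilon> * h $ 3 * f $ 4)\<^sup>2
       + (\<epsilon> * f $ 1 * h $ 4 + f $ 3 * h $ 2 - \<epsilon> * h $ 1 * f $ 4 - h $ 3 * f $ 2)\<^sup>2)"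
  unfolding det_4 model_J_def vector_4 using assms by algebra

text \<open>
  The coframe has positive determinant, so the sign can be read off from the constant model.
\<close>

lemma sgn_J_det_kerr:
  assumes p: "p \<in> kerr_region M \<alpha>" and \<epsilon>: "\<epsilon>\<^sup>2 = 1" and nz: "J_det (kerr_J M \<alpha> \<epsilon>) p v w \<noteq> 0"
  shows "sgn (J_det (kerr_J M \<alpha> \<epsilon>) p v w) = - \<epsilon>"
proof -
  let ?F = "kerr_coframe M \<alpha> p" and ?J = "kerr_J M \<alpha> \<epsilon> p"
  have S: "kerr_Sigma \<alpha> p = (p $ 1)\<^sup>2 - \<alpha>\<^sup>2 + \<alpha>\<^sup>2 * (sin (p $ 2))\<^sup>2"
    by (simp add: kerr_Sigma_def sin_squared_eq algebra_simps)
  have pos: "kerr_Sigma \<alpha> p > 0" "kerr_Delta M \<alpha> p > 0" "sin (p $ 2) > 0"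
    using p sin_gt_zero by (auto simp: kerr_region_def)
  have "det (matrix ?F) = kerr_Sigma \<alpha> p / kerr_Delta M \<alpha> p * (kerr_Sigma \<alpha> p / sin (p $ 2)) *
     ((p $ 1)\<^sup>2 - \<alpha>\<^sup>2 + \<alpha>\<^sup>2 * (sin (p $ 2))\<^sup>2)"
    unfolding det_4 using kerr_region_nonzero[OF p]
    by (simp add: matrix_def kerr_coframe_def Let_def axis_def) (simp add: field_simps power2_eq_square)
  then have F: "det (matrix ?F) > 0"
    unfolding S[symmetric] using pos by simp
  have F_eq: "(\<Sum>k\<in>UNIV. x $ k * matrix ?F $ j $ k) = ?F x $ j" for x j
    using matrix_vector_mul(2)[OF linear_kerr_coframe[of M \<alpha> p], THEN fun_cong, of x]
    by (simp add: matrix_vector_mult_def vec_eq_iff mult_ac)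
  have "vector [v, ?J v, w, ?J w] ** transpose (matrix ?F) =
      (vector [?F v, model_J \<epsilon> (?F v), ?F w, model_J \<epsilon> (?F w)] :: real ^ 4 ^ 4)"
    unfolding vec_eq_iff forall_4[where P = "\<lambda>i. \<forall>j. _ $ i $ j = _ $ i $ j"] vector_4
      matrix_matrix_mult_def transpose_def
    by (simp add: F_eq flip: kerr_coframe_J[OF p])
  then have "J_det (kerr_J M \<alpha> \<epsilon>) p v w * det (matrix ?F)
      = det (vector [?F v, model_J \<epsilon> (?F v), ?F w, model_J \<epsilon> (?F w)] :: real ^ 4 ^ 4)"
    unfolding J_det_def by (metis det_mul det_transpose)
  also obtain a b where "\<dots> = - \<epsilon> * (a\<^sup>2 + b\<^sup>2)"
    using det_model_J[OF \<epsilon>] by blast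
  finally have eq: "J_det (kerr_J M \<alpha> \<epsilon>) p v w * det (matrix ?F) = - \<epsilon> * (a\<^sup>2 + b\<^sup>2)" .
  with nz F have "a\<^sup>2 + b\<^sup>2 > 0"
    by (metis less_irrefl mult_eq_0_iff sum_power2_gt_zero_iff add.right_neutral power_zero_numeral mult_zero_right)
  then have "sgn (J_det (kerr_J M \<alpha> \<epsilon>) p v w) * 1 = sgn (- \<epsilon>) * 1"
    using arg_cong[OF eq, of sgn] F by (simp add: sgn_mult)
  moreover have "\<epsilon> = 1 \<or> \<epsilon> = - 1" using \<epsilon> by (simp add: power2_eq_1_iff)
  ultimately show ?thesis by auto
qed

text \<open>
  The product rule for an endomorphism applied to a field, obtained by expanding the field in the
  standard basis.
\<close>

lemma has_derivative_app_endo: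
  assumes lin: "\<And>q. linear (J q)" "\<And>u. linear (DJ u)"
    and DJ: "\<And>v. ((\<lambda>q. J q v) has_derivative (\<lambda>u. DJ u v)) (at p)"
    and X: "(X has_derivative DX) (at p)"
  shows "(app_endo J X has_derivative (\<lambda>u. DJ u (X p) + J p (DX u))) (at p)"
proof -
  have exp: "L v = (\<Sum>i\<in>UNIV. v $ i *\<^sub>R L (axis i 1))" if "linear L" for L :: "pt \<Rightarrow> pt" and v
  proof -
    have "L v = L (\<Sum>i\<in>UNIV. v $ i *\<^sub>R axis i 1)"
      using basis_expansion[of v] by (simp add: scalar_mult_eq_scaleR)
    then show ?thesis by (simp add: linear_sum[OF that] linear_scale[OF that])
  qed
  have "((\<lambda>q. \<Sum>i\<in>UNIV. X q $ i *\<^sub>R J q (axis i 1)) has_derivative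
    (\<lambda>u. \<Sum>i\<in>UNIV. X p $ i *\<^sub>R DJ u (axis i 1) + DX u $ i *\<^sub>R J p (axis i 1))) (at p)"
    by (intro has_derivative_sum has_derivative_scaleR DJ
        bounded_linear.has_derivative[OF bounded_linear_vec_nth X])
  moreover have "(\<lambda>q. \<Sum>i\<in>UNIV. X q $ i *\<^sub>R J q (axis i 1)) = app_endo J X"
    by (simp add: fun_eq_iff app_endo_def exp[OF lin(1), symmetric])
  ultimately show ?thesis
    by (simp add: sum.distrib exp[OF lin(1), symmetric] exp[OF lin(2), symmetric])
qed

text \<open>
  The derivatives of \<open>X\<close> and \<open>Y\<close> cancel in pairs because \<open>J\<^sup>2 = - 1\<close>: what remains is tensorial and
  contains derivatives of \<open>J\<close> only.
\<close>

lemma nijenhuis_eq: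
  assumes lin: "\<And>q. linear (J q)" "\<And>u. linear (DJ u)"
    and DJ: "\<And>v. ((\<lambda>q. J q v) has_derivative (\<lambda>u. DJ u v)) (at p)"
    and X: "(X has_derivative DX) (at p)" and Y: "(Y has_derivative DY) (at p)"
    and JJ: "\<And>v. J p (J p v) = - v"
  shows "nijenhuis J X Y p = DJ (J p (X p)) (Y p) - DJ (J p (Y p)) (X p)
    + J p (DJ (Y p) (X p)) - J p (DJ (X p) (Y p))"
proof -
  note D = has_derivative_app_endo[OF lin DJ X] has_derivative_app_endo[OF lin DJ Y] X Y
  note f = D[THEN frechet_derivative_at, symmetric]
  show ?thesis
    unfolding nijenhuis_def lie_bracket_def f
    by (simp add: app_endo_def linear_add[OF lin(1)] linear_diff[OF lin(1)] JJ)
qed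

definition kerr_J_deriv :: "real \<Rightarrow> real \<Rightarrow> real \<Rightarrow> pt \<Rightarrow> pt \<Rightarrow> pt \<Rightarrow> pt" where
  "kerr_J_deriv M \<alpha> \<epsilon> p u v =
     (let r = p $ 1; s = sin (p $ 2); c = cos (p $ 2); S = kerr_Sigma \<alpha> p; D = kerr_Delta M \<alpha> p; \<rho> = r\<^sup>2 - \<alpha>\<^sup>2;
          \<sigma> = v $ 3 + \<alpha> * s\<^sup>2 * v $ 4; \<tau> = \<rho> * v $ 4 - \<alpha> * v $ 3 in
      u $ 1 *\<^sub>R vector [- ((2 * (r - M) / S - 2 * r * D / S\<^sup>2) * \<sigma>),
          - (\<epsilon> * s * (2 * r * v $ 4 / S - 2 * r * \<tau> / S\<^sup>2)),
          (2 * r / D - 2 * \<rho> * (r - M) / D\<^sup>2) * v $ 1, - (2 * \<alpha> * (r - M) / D\<^sup>2) * v $ 1]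
      + u $ 2 *\<^sub>R vector [- (2 * \<alpha> * s * c * D / S * v $ 4 - 2 * \<alpha>\<^sup>2 * c * s * D / S\<^sup>2 * \<sigma>),
          - (\<epsilon> * \<tau> * (c / S - 2 * \<alpha>\<^sup>2 * c * s\<^sup>2 / S\<^sup>2)), - (\<epsilon> * \<alpha> * c * v $ 2), - (\<epsilon> * c / s\<^sup>2 * v $ 2)])"

lemma kerr_J_has_derivative:
  assumes p: "p \<in> kerr_region M \<alpha>"
  shows "((\<lambda>q. kerr_J M \<alpha> \<epsilon> q v) has_derivative (\<lambda>u. kerr_J_deriv M \<alpha> \<epsilon> p u v)) (at p)"
proof (rule has_derivative_vecI)
  fix i
  note nz = kerr_region_nonzero[OF p]
  have "\<forall>i. grad2 (\<lambda>q. kerr_J M \<alpha> \<epsilon> q v $ i) p (kerr_J_deriv M \<alpha> \<epsilon> p (axis 1 1) v $ i)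
      (kerr_J_deriv M \<alpha> \<epsilon> p (axis 2 1) v $ i)"
    unfolding forall_4 kerr_J_def Let_def vector_4
    by (intro conjI; (rule grad2_cong, (rule grad2_intros nz power_not_zero)+);
        simp add: kerr_J_deriv_def Let_def axis_def; simp add: divide_simps nz; algebra)
  then have "grad2 (\<lambda>q. kerr_J M \<alpha> \<epsilon> q v $ i) p (kerr_J_deriv M \<alpha> \<epsilon> p (axis 1 1) v $ i)
      (kerr_J_deriv M \<alpha> \<epsilon> p (axis 2 1) v $ i)" by blast
  then show "((\<lambda>q. kerr_J M \<alpha> \<epsilon> q v $ i) has_derivative (\<lambda>u. kerr_J_deriv M \<alpha> \<epsilon> p u v $ i)) (at p)"
    unfolding grad2_def
    by (rule has_derivative_eq_rhs) (simp add: fun_eq_iff kerr_J_deriv_def Let_def axis_def)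
qed

text \<open>
  By \<open>nijenhuis_eq\<close> the claim is, at each point, an identity for bilinear expressions in two vectors.
\<close>

lemma nijenhuis_kerr_J:
  assumes p: "p \<in> kerr_region M \<alpha>" and \<epsilon>: "\<epsilon>\<^sup>2 = 1"
    and X: "(X has_derivative DX) (at p)" and Y: "(Y has_derivative DY) (at p)"
  shows "nijenhuis (kerr_J M \<alpha> \<epsilon>) X Y p = 0"
proof -
  note nz = kerr_region_nonzero[OF p]
  note rel = kerr_relations(1)[of \<alpha> p] kerr_relations(2)[of M \<alpha> p] kerr_relations(3)[of p]
  have lin: "linear (kerr_J_deriv M \<alpha> \<epsilon> p u)" for u
    unfolding kerr_J_deriv_def Let_def
    by (intro linearI; unfold vec_eq_iff forall_4;
      simp add: algebra_simps add_divide_distrib diff_divide_distrib)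
  let ?D = "kerr_J_deriv M \<alpha> \<epsilon> p" and ?J = "kerr_J M \<alpha> \<epsilon> p"
  have "?D (?J v) w - ?D (?J w) v + ?J (?D w v) - ?J (?D v w) = 0" for v w
    unfolding vec_eq_iff forall_4 kerr_J_def kerr_J_deriv_def Let_def vector_4
      vector_add_component vector_minus_component vector_scaleR_component zero_index
    by (intro conjI; simp add: divide_simps nz; use rel \<epsilon> in algebra)
  then show ?thesis
    using nijenhuis_eq[OF linear_kerr_J lin kerr_J_has_derivative[OF p] X Y kerr_J_square[OF p \<epsilon>]] by simp
qed

lemma tphi_shift_nth [simp]:
  "tphi_shift s $ 1 = 0" "tphi_shift s $ 2 = 0" "tphi_shift s $ 3 = s $ 1" "tphi_shift s $ 4 = s $ 2"
  by (simp_all add: tphi_shift_def axis_def)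

lemma kerr_shift_invariant:
  "kerr_Delta M \<alpha> (p + tphi_shift s) = kerr_Delta M \<alpha> p"
  "kerr_Sigma \<alpha> (p + tphi_shift s) = kerr_Sigma \<alpha> p"
  "kerr_metric M \<alpha> (p + tphi_shift s) = kerr_metric M \<alpha> p"
  "kerr_J M \<alpha> \<epsilon> (p + tphi_shift s) = kerr_J M \<alpha> \<epsilon> p"
  "p + tphi_shift s \<in> kerr_region M \<alpha> \<longleftrightarrow> p \<in> kerr_region M \<alpha>"
  by (simp_all add: kerr_Delta_def kerr_Sigma_def kerr_metric_def kerr_J_def kerr_region_def
      fun_eq_iff Let_def)

lemma complex_structure_kerr_J:
  assumes "\<epsilon>\<^sup>2 = 1"
  shows "complex_structure (kerr_region M \<alpha>) (tphi_shift ` \<Lambda>) (kerr_J M \<alpha> \<epsilon>)"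
proof -
  have "nijenhuis (kerr_J M \<alpha> \<epsilon>) X Y p = 0"
    if "smooth_on (kerr_region M \<alpha>) X" "smooth_on (kerr_region M \<alpha>) Y" "p \<in> kerr_region M \<alpha>" for X Y p
    by (rule nijenhuis_kerr_J[OF that(3) assms smooth_on_differentiable[OF open_kerr_region that(1,3)]
          smooth_on_differentiable[OF open_kerr_region that(2,3)]])
  then show ?thesis
    unfolding complex_structure_def descends_def
    using linear_kerr_J kerr_J_square[OF _ assms] smooth_on_kerr_J
    by (simp add: kerr_shift_invariant)
qed

section \<open>The two Kaehler metrics\<close>

text \<open>
  This is x + \<epsilon> y in the ambitoric coordinates.
\<close>

definition kahler_scale :: "real \<Rightarrow> real \<Rightarrow> pt \<Rightarrow> real" where
  "kahler_scale \<alpha> \<epsilon> p = p $ 1 + \<epsilon> * (\<alpha> * cos (p $ 2))"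

lemma kahler_scale_nonzero:
  assumes p: "p \<in> kerr_region M \<alpha>" and \<epsilon>: "\<epsilon>\<^sup>2 = 1"
  shows "kahler_scale \<alpha> \<epsilon> p \<noteq> 0"
proof
  assume "kahler_scale \<alpha> \<epsilon> p = 0"
  moreover have "kerr_Sigma \<alpha> p = kahler_scale \<alpha> \<epsilon> p * (p $ 1 - \<epsilon> * (\<alpha> * cos (p $ 2)))"
    using \<epsilon> unfolding kerr_Sigma_def kahler_scale_def by algebra
  ultimately show False using p by (auto simp: kerr_region_def)
qed

lemma kahler_scale_product: "kahler_scale \<alpha> 1 p * kahler_scale \<alpha> (- 1) p = kerr_Sigma \<alpha> p"
  by (simp add: kahler_scale_def kerr_Sigma_def algebra_simps power2_eq_square)

lemma smooth_on_kahler_scale: "open U \<Longrightarrow> smooth_on U (kahler_scale \<alpha> \<epsilon>)"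
  unfolding kahler_scale_def[abs_def] by (intro smooth_intros)

lemma grad2_kahler_scale: "grad2 (kahler_scale \<alpha> \<epsilon>) p 1 (- \<epsilon> * (\<alpha> * sin (p $ 2)))"
  unfolding kahler_scale_def[abs_def]
  by (rule grad2_cong, (rule grad2_intros)+, simp_all)

lemma kahler_scale_shift: "kahler_scale \<alpha> \<epsilon> (p + tphi_shift s) = kahler_scale \<alpha> \<epsilon> p"
  by (simp add: kahler_scale_def)

definition kerr_kahler_metric :: "real \<Rightarrow> real \<Rightarrow> real \<Rightarrow> tensor2" where
  "kerr_kahler_metric M \<alpha> \<epsilon> p v w = kerr_metric M \<alpha> p v w / (kahler_scale \<alpha> \<epsilon> p)\<^sup>2"

text \<open>
  Positive multiples of a positive definite symmetric form; smoothness is required of the product only,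
  which lets the lemma serve for the Kerr metric and for its conformal rescalings.
\<close>

lemma riemannian_metric_scale:
  assumes "\<And>v w. smooth_on U (\<lambda>p. h p v w)" "descends U \<Gamma> h"
    and "\<And>p v w. p \<in> U \<Longrightarrow> h p v w = u p * g p v w" "\<And>p. p \<in> U \<Longrightarrow> u p > 0"
    and "\<And>p. p \<in> U \<Longrightarrow> bilinear (g p)"
    and "\<And>p v w. p \<in> U \<Longrightarrow> g p v w = g p w v" "\<And>p v. p \<in> U \<Longrightarrow> v \<noteq> 0 \<Longrightarrow> g p v v > 0"
  shows "riemannian_metric U \<Gamma> h"
proof -
  have "bilinear (h p)" if "p \<in> U" for p
  proof -
    have "h p = (\<lambda>v w. u p * g p v w)" using assms(3)[OF that] by blast
    then show ?thesis
      using assms(5)[OF that] unfolding bilinear_def linear_iff by (auto simp: algebra_simps)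
  qed
  then show ?thesis
    using assms by (auto simp: riemannian_metric_def smooth_tensor2_def)
qed

lemma riemannian_metric_kerr: "riemannian_metric (kerr_region M \<alpha>) (tphi_shift ` \<Lambda>) (kerr_metric M \<alpha>)"
  by (rule riemannian_metric_scale[where u = "\<lambda>p. 1" and g = "kerr_metric M \<alpha>"])
    (auto simp: smooth_on_kerr_metric descends_def kerr_shift_invariant kerr_metric_bilinear
      kerr_metric_sym kerr_metric_pos)

lemma riemannian_metric_kerr_kahler:
  assumes "\<epsilon>\<^sup>2 = 1"
  shows "riemannian_metric (kerr_region M \<alpha>) (tphi_shift ` \<Lambda>) (kerr_kahler_metric M \<alpha> \<epsilon>)"
proof (rule riemannian_metric_scale[where u = "\<lambda>p. 1 / (kahler_scale \<alpha> \<epsilon> p)\<^sup>2" and g = "kerr_metric M \<alpha>"])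
  show "smooth_on (kerr_region M \<alpha>) (\<lambda>p. kerr_kahler_metric M \<alpha> \<epsilon> p v w)" for v w
    unfolding kerr_kahler_metric_def
    by (intro smooth_intros open_kerr_region smooth_on_kerr_metric smooth_on_kahler_scale
        power_not_zero kahler_scale_nonzero[OF _ assms])
  show "0 < 1 / (kahler_scale \<alpha> \<epsilon> p)\<^sup>2" if "p \<in> kerr_region M \<alpha>" for p
    using kahler_scale_nonzero[OF that assms] by simp
qed (auto simp: descends_def kerr_kahler_metric_def kerr_shift_invariant fun_eq_iff kahler_scale_shift
  kerr_metric_bilinear kerr_metric_pos intro: kerr_metric_sym)

text \<open>
  The form dx \<and> (dt1 + y^2 dt2) + \<epsilon> dy \<and> (dt1 + x^2 dt2), divided by (x + \<epsilon> y)^2, in Kerr coordinates;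
  there dy = - \<alpha> sin \<theta> d\<theta> and dt1 + x^2 dt2 = - \<tau> / \<alpha>.
\<close>

definition kerr_kahler_form :: "real \<Rightarrow> real \<Rightarrow> tensor2" where
  "kerr_kahler_form \<alpha> \<epsilon> p v w =
     (let r = p $ 1; s = sin (p $ 2);
          \<sigma> = (\<lambda>u::pt. u $ 3 + \<alpha> * s\<^sup>2 * u $ 4); \<tau> = (\<lambda>u::pt. (r\<^sup>2 - \<alpha>\<^sup>2) * u $ 4 - \<alpha> * u $ 3)
      in (v $ 1 * \<sigma> w - w $ 1 * \<sigma> v + \<epsilon> * s * (v $ 2 * \<tau> w - w $ 2 * \<tau> v)) / (kahler_scale \<alpha> \<epsilon> p)\<^sup>2)"

lemma fundamental_form_kerr:
  assumes p: "p \<in> kerr_region M \<alpha>" and \<epsilon>: "\<epsilon>\<^sup>2 = 1"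
  shows "fundamental_form (kerr_kahler_metric M \<alpha> \<epsilon>) (kerr_J M \<alpha> \<epsilon>) p v w = kerr_kahler_form \<alpha> \<epsilon> p v w"
proof -
  have "kerr_metric M \<alpha> p (kerr_J M \<alpha> \<epsilon> p v) w =
      (let f = kerr_coframe M \<alpha> p v; f' = kerr_coframe M \<alpha> p w in
      kerr_Delta M \<alpha> p / kerr_Sigma \<alpha> p * (f $ 1 * f' $ 3 - f $ 3 * f' $ 1)
      + (sin (p $ 2))\<^sup>2 / kerr_Sigma \<alpha> p * \<epsilon> * (f $ 2 * f' $ 4 - f $ 4 * f' $ 2))"
    unfolding kerr_metric_coframe[OF p] kerr_coframe_J[OF p]
    by (simp add: Let_def model_J_def algebra_simps)
  also have "\<dots> = kerr_kahler_form \<alpha> \<epsilon> p v w * (kahler_scale \<alpha> \<epsilon> p)\<^sup>2"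
    using kerr_region_nonzero[OF p] kahler_scale_nonzero[OF p \<epsilon>]
    by (simp add: kerr_kahler_form_def kerr_coframe_def Let_def) (simp add: field_simps power2_eq_square)
  finally show ?thesis
    using kahler_scale_nonzero[OF p \<epsilon>] by (simp add: fundamental_form_def kerr_kahler_metric_def)
qed

text \<open>
  The form is a sum of a dr \<and> dt + b d\<theta> \<and> dt + c dr \<and> d\<phi> + e d\<theta> \<and> d\<phi> with coefficients in r and \<theta>
  such that a dr + b d\<theta> and c dr + e d\<theta> are closed.
\<close>

lemma ext_deriv2_kerr:
  assumes p: "p \<in> kerr_region M \<alpha>" and \<epsilon>: "\<epsilon>\<^sup>2 = 1"
  shows "ext_deriv2 (fundamental_form (kerr_kahler_metric M \<alpha> \<epsilon>) (kerr_J M \<alpha> \<epsilon>)) p u v w = 0"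
proof -
  note nz = kahler_scale_nonzero[OF p \<epsilon>]
  let ?\<omega> = "kerr_kahler_form \<alpha> \<epsilon>"
  let ?r = "p $ 1" and ?s = "sin (p $ 2)" and ?c = "cos (p $ 2)" and ?N = "kahler_scale \<alpha> \<epsilon> p"
  define \<sigma> \<tau> where "\<sigma> = (\<lambda>u::pt. u $ 3 + \<alpha> * ?s\<^sup>2 * u $ 4)"
    and "\<tau> = (\<lambda>u::pt. (?r\<^sup>2 - \<alpha>\<^sup>2) * u $ 4 - \<alpha> * u $ 3)"
  define F where "F = (\<lambda>v w. v $ 1 * \<sigma> w - w $ 1 * \<sigma> v + \<epsilon> * ?s * (v $ 2 * \<tau> w - w $ 2 * \<tau> v))"
  have g: "grad2 (\<lambda>q. ?\<omega> q v w) p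
     (2 * \<epsilon> * ?s * ?r * (v $ 2 * w $ 4 - w $ 2 * v $ 4) / ?N\<^sup>2 - 2 * F v w / ?N ^ 3)
     ((2 * \<alpha> * ?s * ?c * (v $ 1 * w $ 4 - w $ 1 * v $ 4) + \<epsilon> * ?c * (v $ 2 * \<tau> w - w $ 2 * \<tau> v)) / ?N\<^sup>2
      + 2 * \<epsilon> * \<alpha> * ?s * F v w / ?N ^ 3)" for v w
    unfolding kerr_kahler_form_def Let_def
    by (rule grad2_cong, (rule grad2_intros grad2_kahler_scale nz power_not_zero)+;
        simp add: F_def \<sigma>_def \<tau>_def; simp add: divide_simps nz; algebra)
  have f: "frechet_derivative (\<lambda>q. fundamental_form (kerr_kahler_metric M \<alpha> \<epsilon>) (kerr_J M \<alpha> \<epsilon>) q v w) (at p)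
      = frechet_derivative (\<lambda>q. ?\<omega> q v w) (at p)" for v w
    by (rule frechet_derivative_cong_open[OF open_kerr_region p]) (rule fundamental_form_kerr[OF _ \<epsilon>])
  have N: "?N = ?r + \<epsilon> * (\<alpha> * ?c)" by (simp add: kahler_scale_def)
  note s = kerr_relations(3)[where p = p]
  show ?thesis
    unfolding ext_deriv2_def f grad2_frechet[OF g] F_def \<sigma>_def \<tau>_def
    by (simp add: divide_simps nz) (use \<epsilon> N s in algebra)
qed

lemma kaehler_kerr:
  assumes "\<epsilon>\<^sup>2 = 1"
  shows "kaehler (kerr_region M \<alpha>) (tphi_shift ` \<Lambda>) (kerr_kahler_metric M \<alpha> \<epsilon>) (kerr_J M \<alpha> \<epsilon>)"
  unfolding kaehler_def hermitian_def
  using riemannian_metric_kerr_kahler[OF assms] complex_structure_kerr_J[OF assms] ext_deriv2_kerr[OF _ assms]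
  by (auto simp: kerr_kahler_metric_def kerr_metric_J[OF _ assms])

lemma conformal_class_kerr_kahler:
  assumes \<epsilon>: "\<epsilon>\<^sup>2 = 1"
  shows "kerr_kahler_metric M \<alpha> \<epsilon> \<in> conformal_class (kerr_region M \<alpha>) (tphi_shift ` \<Lambda>) (kerr_metric M \<alpha>)"
proof -
  have "smooth_on (kerr_region M \<alpha>) (\<lambda>p. 1 / (kahler_scale \<alpha> \<epsilon> p)\<^sup>2)"
    by (intro smooth_intros open_kerr_region smooth_on_kahler_scale power_not_zero kahler_scale_nonzero[OF _ \<epsilon>])
  then show ?thesis
    using kahler_scale_nonzero[OF _ \<epsilon>]
    by (auto simp: conformal_class_def descends_def kerr_kahler_metric_def kerr_shift_invariant
        kahler_scale_shift fun_eq_iff intro!: exI[of _ "\<lambda>p. 1 / (kahler_scale \<alpha> \<epsilon> p)\<^sup>2"])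
qed

lemma barycentric_kerr:
  "barycentric (kerr_region M \<alpha>) (kerr_kahler_metric M \<alpha> 1) (kerr_kahler_metric M \<alpha> (- 1))
    (\<lambda>p. kahler_scale \<alpha> 1 p / kahler_scale \<alpha> (- 1) p) (\<lambda>p v w. kerr_metric M \<alpha> p v w / kerr_Sigma \<alpha> p)"
proof -
  have nz: "kahler_scale \<alpha> 1 p \<noteq> 0" "kahler_scale \<alpha> (- 1) p \<noteq> 0" if "p \<in> kerr_region M \<alpha>" for p
    using kahler_scale_nonzero[OF that] by simp_all
  moreover have "0 < kahler_scale \<alpha> 1 p / kahler_scale \<alpha> (- 1) p" if "p \<in> kerr_region M \<alpha>" for p
  proof -
    have "0 < kahler_scale \<alpha> 1 p * kahler_scale \<alpha> (- 1) p"
      unfolding kahler_scale_product using that by (simp add: kerr_region_def)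
    then show ?thesis by (simp add: zero_less_mult_iff zero_less_divide_iff)
  qed
  moreover have "smooth_on (kerr_region M \<alpha>) (\<lambda>p. kahler_scale \<alpha> 1 p / kahler_scale \<alpha> (- 1) p)"
    by (intro smooth_intros open_kerr_region smooth_on_kahler_scale nz)
  ultimately show ?thesis
    unfolding barycentric_def kerr_kahler_metric_def kahler_scale_product[symmetric]
    by (simp add: field_simps power2_eq_square)
qed

section \<open>The torus action and its moment maps\<close>

lemma linear_tphi_shift: "linear tphi_shift"
  by (rule linearI) (simp_all add: vec_eq_iff forall_4)

lemma inj_tphi_shift: "inj tphi_shift"
  by (rule injI) (auto simp: vec_eq_iff forall_4 forall_2)

lemma generator_tphi: "generator tphi_action a p = tphi_shift a"
proof -
  have "((\<lambda>t. p + t *\<^sub>R tphi_shift a) has_vector_derivative tphi_shift a) (at 0)"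
    by (auto intro!: derivative_eq_intros simp: has_vector_derivative_def)
  then show ?thesis
    unfolding generator_def tphi_action_def
    by (simp add: linear_scale[OF linear_tphi_shift] vector_derivative_at)
qed

text \<open>
  An injective linear map carries a basis of the lattice to a basis of its image.
\<close>

lemma discrete_lattice_image:
  assumes "full_lattice \<Lambda>" "linear l" "inj l"
  shows "discrete_lattice (l ` \<Lambda>)"
proof -
  obtain B where B: "independent B" "\<Lambda> = {\<Sum>b\<in>B. real_of_int (n b) *\<^sub>R b |n. True}"
    using assms(1) by (auto simp: full_lattice_def generates_lattice_def)
  have inj: "inj_on l B" using assms(3) by (rule inj_on_subset) simp
  have sum: "l (\<Sum>b\<in>B. real_of_int (n b) *\<^sub>R b) = (\<Sum>b\<in>l ` B. real_of_int (n (inv l b)) *\<^sub>R b)" for n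
    by (simp add: sum.reindex[OF inj] linear_sum[OF assms(2)] linear_scale[OF assms(2)] inv_f_f[OF assms(3)])
  have "l ` \<Lambda> = {\<Sum>b\<in>l ` B. real_of_int (n b) *\<^sub>R b |n. True}"
  proof (intro equalityI subsetI)
    fix x assume "x \<in> l ` \<Lambda>"
    then show "x \<in> {\<Sum>b\<in>l ` B. real_of_int (n b) *\<^sub>R b |n. True}"
      using sum by (auto simp: B(2))
  next
    fix x assume "x \<in> {\<Sum>b\<in>l ` B. real_of_int (n b) *\<^sub>R b |n. True}"
    then obtain n where x: "x = (\<Sum>b\<in>l ` B. real_of_int (n b) *\<^sub>R b)" by auto
    have "x = l (\<Sum>b\<in>B. real_of_int (n (l b)) *\<^sub>R b)"
      unfolding x by (simp add: sum.reindex[OF inj] linear_sum[OF assms(2)] linear_scale[OF assms(2)])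
    moreover have "(\<Sum>b\<in>B. real_of_int (n (l b)) *\<^sub>R b) \<in> \<Lambda>"
      unfolding B(2) by (auto intro!: exI[of _ "\<lambda>b. n (l b)"])
    ultimately show "x \<in> l ` \<Lambda>" by blast
  qed
  moreover have "independent (l ` B)"
    using linear_independent_injective_image[OF assms(2) B(1)] assms(3) by (simp add: inj_on_subset)
  ultimately show ?thesis
    unfolding discrete_lattice_def generates_lattice_def by blast
qed

lemma torus_action_tphi:
  assumes "full_lattice \<Lambda>" and U: "open U" "U \<noteq> {}" "\<And>p s. p \<in> U \<Longrightarrow> p + tphi_shift s \<in> U"
  shows "torus_action U (tphi_shift ` \<Lambda>) \<Lambda> tphi_action"
proof -
  have "bounded_linear (\<lambda>z. snd z + tphi_shift (fst z))"
    by (intro bounded_linear_add bounded_linear_snd bounded_linear_compose[OF _ bounded_linear_fst]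
        linear_linear[THEN iffD2] linear_tphi_shift)
  then have "smooth_on (UNIV \<times> U) (\<lambda>z. snd z + tphi_shift (fst z))"
    by (intro smooth_on_linear open_Times U(1)) auto
  moreover have "(\<forall>p\<in>U. \<exists>\<gamma>\<in>tphi_shift ` \<Lambda>. p + tphi_shift s = p + \<gamma>) \<longleftrightarrow> s \<in> \<Lambda>" for s
    using U(2) inj_image_mem_iff[OF inj_tphi_shift] by auto
  ultimately show ?thesis
    using assms
    by (simp add: torus_action_def tphi_action_def case_prod_unfold linear_0[OF linear_tphi_shift]
        linear_add[OF linear_tphi_shift] add_ac)
qed

lemma quotient_manifold_kerr:
  "full_lattice \<Lambda> \<Longrightarrow> quotient_manifold (kerr_region M \<alpha>) (tphi_shift ` \<Lambda>)"
  unfolding quotient_manifold_def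
  using open_kerr_region kerr_region_nonempty discrete_lattice_image[OF _ linear_tphi_shift inj_tphi_shift]
  by (auto simp: kerr_shift_invariant)

lemma acts_by_isometries_tphi:
  assumes "\<And>s p. g (p + tphi_shift s) = g p"
  shows "acts_by_isometries U g tphi_action"
proof -
  have "frechet_derivative (tphi_action s) (at p) = (\<lambda>v. v)" for s p
    unfolding tphi_action_def[abs_def]
    by (rule frechet_derivative_at[symmetric]) (auto intro!: derivative_eq_intros)
  then show ?thesis
    using assms by (simp add: acts_by_isometries_def tphi_action_def)
qed

text \<open>
  With N = x + \<epsilon> y, the coordinate fields of t1 and t2 have the momenta - 1 / N and \<epsilon> x y / N. The
  components here belong to the combinations \<partial>_t = \<partial>_t1 and \<partial>_\<phi> = \<alpha> \<partial>_t1 - \<partial>_t2 / \<alpha>.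
\<close>

definition kerr_moment :: "real \<Rightarrow> real \<Rightarrow> pt \<Rightarrow> real ^ 2" where
  "kerr_moment \<alpha> \<epsilon> p = vector [- 1 / kahler_scale \<alpha> \<epsilon> p,
     - (\<alpha> + \<epsilon> * p $ 1 * cos (p $ 2)) / kahler_scale \<alpha> \<epsilon> p]"

lemma hamiltonian_kerr:
  assumes \<epsilon>: "\<epsilon>\<^sup>2 = 1"
  shows "hamiltonian (kerr_region M \<alpha>) (tphi_shift ` \<Lambda>)
    (fundamental_form (kerr_kahler_metric M \<alpha> \<epsilon>) (kerr_J M \<alpha> \<epsilon>)) tphi_action"
proof -
  have "smooth_on (kerr_region M \<alpha>) (kerr_moment \<alpha> \<epsilon>)"
  proof (rule smooth_on_vecI[OF open_kerr_region])
    fix i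
    have "\<forall>i. smooth_on (kerr_region M \<alpha>) (\<lambda>p. kerr_moment \<alpha> \<epsilon> p $ i)"
      unfolding forall_2 kerr_moment_def vector_2
      by (intro conjI smooth_intros open_kerr_region smooth_on_kahler_scale kahler_scale_nonzero[OF _ \<epsilon>])
    then show "smooth_on (kerr_region M \<alpha>) (\<lambda>p. kerr_moment \<alpha> \<epsilon> p $ i)" by blast
  qed
  moreover have "frechet_derivative (\<lambda>q. a \<bullet> kerr_moment \<alpha> \<epsilon> q) (at p) v
      = - kerr_kahler_form \<alpha> \<epsilon> p (tphi_shift a) v" if p: "p \<in> kerr_region M \<alpha>" for a p v
  proof -
    note nz = kahler_scale_nonzero[OF p \<epsilon>]
    have N: "kahler_scale \<alpha> \<epsilon> p = p $ 1 + \<epsilon> * (\<alpha> * cos (p $ 2))" by (simp add: kahler_scale_def)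
    note s = kerr_relations(3)[where p = p]
    have "grad2 (\<lambda>q. a \<bullet> kerr_moment \<alpha> \<epsilon> q) p
      ((a $ 1 + a $ 2 * (\<alpha> * (sin (p $ 2))\<^sup>2)) / (kahler_scale \<alpha> \<epsilon> p)\<^sup>2)
      (\<epsilon> * sin (p $ 2) * (((p $ 1)\<^sup>2 - \<alpha>\<^sup>2) * a $ 2 - \<alpha> * a $ 1) / (kahler_scale \<alpha> \<epsilon> p)\<^sup>2)"
      unfolding kerr_moment_def inner_vec_def sum_2 vector_2 inner_real_def
      by (rule grad2_cong, (rule grad2_intros grad2_kahler_scale nz)+)
        (simp_all add: divide_simps nz, (use \<epsilon> N s in algebra)+)
    from grad2_frechet[OF this] show ?thesis
      by (simp add: kerr_kahler_form_def Let_def) (simp add: divide_inverse algebra_simps)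
  qed
  ultimately show ?thesis
    unfolding hamiltonian_def generator_tphi
    by (intro exI[of _ "kerr_moment \<alpha> \<epsilon>"])
      (auto simp: descends_def kerr_moment_def tphi_action_def kahler_scale_shift fundamental_form_kerr[OF _ \<epsilon>])
qed

lemma ambitoric_kerr:
  assumes "full_lattice \<Lambda>"
  shows "ambitoric (kerr_region M \<alpha>) (tphi_shift ` \<Lambda>)
    (conformal_class (kerr_region M \<alpha>) (tphi_shift ` \<Lambda>) (kerr_metric M \<alpha>))
    (kerr_J M \<alpha> 1) (kerr_J M \<alpha> (- 1)) (kerr_kahler_metric M \<alpha> 1) (kerr_kahler_metric M \<alpha> (- 1))
    \<Lambda> tphi_action"
proof -
  let ?U = "kerr_region M \<alpha>" and ?c = "conformal_class (kerr_region M \<alpha>) (tphi_shift ` \<Lambda>) (kerr_metric M \<alpha>)"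
  have "hermitian ?U h (kerr_J M \<alpha> \<epsilon>)" if "h \<in> ?c" "\<epsilon>\<^sup>2 = 1" for h \<epsilon>
    using that kerr_metric_J by (auto simp: conformal_class_def hermitian_def)
  moreover have "opposite_orientations ?U (kerr_J M \<alpha> 1) (kerr_J M \<alpha> (- 1))"
    by (simp add: opposite_orientations_def sgn_J_det_kerr)
  moreover have "acts_by_isometries ?U (kerr_kahler_metric M \<alpha> \<epsilon>) tphi_action" for \<epsilon>
    by (intro acts_by_isometries_tphi)
      (simp add: fun_eq_iff kerr_kahler_metric_def kerr_shift_invariant kahler_scale_shift)
  ultimately show ?thesis
    using assms riemannian_metric_kerr[of M \<alpha> \<Lambda>] quotient_manifold_kerr conformal_class_kerr_kahler kaehler_kerr
      hamiltonian_kerr torus_action_tphi[OF assms open_kerr_region kerr_region_nonempty]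
    by (auto simp: ambitoric_def kerr_shift_invariant)
qed

section \<open>Regularity\<close>

text \<open>
  The product of the two models is - 1 on the plane (1,3) and + 1 on the plane (2,4). A generator
  has no components along \<open>r\<close> and \<open>\<theta>\<close>, so it is an eigenvector exactly if \<tau>, respectively \<sigma>,
  vanishes on it.
\<close>

lemma eigen_line_kerr:
  assumes p: "p \<in> kerr_region M \<alpha>"
  shows "eigen_line (kerr_J M \<alpha> 1) (kerr_J M \<alpha> (- 1)) tphi_action 1 p
      = {a. ((p $ 1)\<^sup>2 - \<alpha>\<^sup>2) * a $ 2 = \<alpha> * a $ 1}"
    and "eigen_line (kerr_J M \<alpha> 1) (kerr_J M \<alpha> (- 1)) tphi_action (- 1) p
      = {a. a $ 1 + \<alpha> * (sin (p $ 2))\<^sup>2 * a $ 2 = 0}"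
proof -
  let ?F = "kerr_coframe M \<alpha> p"
  have eig: "- kerr_J M \<alpha> 1 p (kerr_J M \<alpha> (- 1) p v) = e *\<^sub>R v \<longleftrightarrow>
      - model_J 1 (model_J (- 1) (?F v)) = e *\<^sub>R ?F v" for e v
  proof -
    have inj: "?F x = ?F y \<longleftrightarrow> x = y" for x y
      using kerr_coframe_inj[OF p, of "x - y"] by (auto simp: linear_diff[OF linear_kerr_coframe])
    show ?thesis
      unfolding inj[symmetric, of "- kerr_J M \<alpha> 1 p (kerr_J M \<alpha> (- 1) p v)"]
      by (simp add: linear_neg[OF linear_kerr_coframe] linear_scale[OF linear_kerr_coframe] kerr_coframe_J[OF p])
  qed
  have F: "?F (tphi_shift a) = vector [0, 0, a $ 1 + \<alpha> * (sin (p $ 2))\<^sup>2 * a $ 2,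
      ((p $ 1)\<^sup>2 - \<alpha>\<^sup>2) * a $ 2 - \<alpha> * a $ 1]" for a
    by (simp add: kerr_coframe_def Let_def)
  show "eigen_line (kerr_J M \<alpha> 1) (kerr_J M \<alpha> (- 1)) tphi_action 1 p
      = {a. ((p $ 1)\<^sup>2 - \<alpha>\<^sup>2) * a $ 2 = \<alpha> * a $ 1}"
    "eigen_line (kerr_J M \<alpha> 1) (kerr_J M \<alpha> (- 1)) tphi_action (- 1) p
      = {a. a $ 1 + \<alpha> * (sin (p $ 2))\<^sup>2 * a $ 2 = 0}"
    unfolding eigen_line_def generator_tphi eig F by (auto simp: model_J_def vec_eq_iff forall_4) algebra+
qed

lemma span_line:
  fixes b :: "real ^ 2"
  assumes "b $ 2 \<noteq> 0"
  shows "span {b} = {a. a $ 1 * b $ 2 = a $ 2 * b $ 1}"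
proof (intro equalityI subsetI)
  fix a :: "real ^ 2" assume "a \<in> {a. a $ 1 * b $ 2 = a $ 2 * b $ 1}"
  then have "a = (a $ 2 / b $ 2) *\<^sub>R b"
    using assms by (simp add: vec_eq_iff forall_2 field_simps)
  then show "a \<in> span {b}"
    by (metis span_base span_scale singletonI)
qed (auto simp: span_singleton)

lemma independent_pair:
  fixes a b :: "real ^ 2"
  assumes "a $ 1 * b $ 2 - a $ 2 * b $ 1 \<noteq> 0"
  shows "independent {a, b}" "a \<noteq> b"
proof -
  show "a \<noteq> b" using assms by auto
  have "b \<noteq> 0" "a \<notin> span {b}" using assms by (auto simp: span_singleton)
  then show "independent {a, b}" by (simp add: independent_insert)
qed

text \<open>
  The affine coordinates r^2 - \<alpha>^2 and sin^2 \<theta> of the two lines have differentials 2 r dr and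
  2 sin \<theta> cos \<theta> d\<theta>. Here r never vanishes, because \<Delta> is negative at r = 0, so only the nowhere
  dense hyperplane \<theta> = pi / 2 has to be removed.
\<close>

lemma regular_ambitoric_kerr:
  assumes \<alpha>: "\<alpha> \<noteq> 0"
  shows "regular_ambitoric (kerr_region M \<alpha>) (kerr_J M \<alpha> 1) (kerr_J M \<alpha> (- 1)) tphi_action"
proof -
  let ?U = "kerr_region M \<alpha>"
  let ?H = "{p :: pt. axis 2 1 \<bullet> p = pi / 2}"
  let ?W = "?U - ?H"
  have H: "p \<in> ?H \<longleftrightarrow> p $ 2 = pi / 2" for p by (simp add: inner_axis')
  have W: "open ?W"
    by (intro open_Diff open_kerr_region closed_hyperplane)
  have "interior ?H = {}"
    by (rule interior_hyperplane) (simp add: vec_eq_iff forall_4 axis_def)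
  then have "closure (- ?H) = UNIV"
    by (simp only: closure_complement) simp
  then have "?U \<subseteq> closure ?W"
    using open_Int_closure_subset[OF open_kerr_region[of M \<alpha>], of "- ?H"] by (simp add: Diff_eq)
  moreover have "proj_wedge_nonzero p (eigen_line (kerr_J M \<alpha> 1) (kerr_J M \<alpha> (- 1)) tphi_action 1)
      (eigen_line (kerr_J M \<alpha> 1) (kerr_J M \<alpha> (- 1)) tphi_action (- 1))" if p: "p \<in> ?W" for p
    unfolding proj_wedge_nonzero_def
  proof (intro exI conjI)
    let ?e = "vector [1, 0] :: real ^ 2" and ?e' = "vector [0, \<alpha>] :: real ^ 2"
    have "\<forall>q\<in>?W. eigen_line (kerr_J M \<alpha> 1) (kerr_J M \<alpha> (- 1)) tphi_action 1 q =
        span {((q $ 1)\<^sup>2 - \<alpha>\<^sup>2) *\<^sub>R ?e + ?e'}"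
    proof
      fix q assume "q \<in> ?W"
      then show "eigen_line (kerr_J M \<alpha> 1) (kerr_J M \<alpha> (- 1)) tphi_action 1 q =
        span {((q $ 1)\<^sup>2 - \<alpha>\<^sup>2) *\<^sub>R ?e + ?e'}"
        using \<alpha> by (auto simp: eigen_line_kerr span_line algebra_simps)
    qed
    moreover have "independent {?e, ?e'}" "?e \<noteq> ?e'"
      using \<alpha> by (auto intro!: independent_pair)
    moreover have "smooth_on ?W (\<lambda>q. (q $ 1)\<^sup>2 - \<alpha>\<^sup>2)"
      by (intro smooth_intros W)
    ultimately show "affine_coord_near p (eigen_line (kerr_J M \<alpha> 1) (kerr_J M \<alpha> (- 1)) tphi_action 1)
        (\<lambda>q. (q $ 1)\<^sup>2 - \<alpha>\<^sup>2)"
      unfolding affine_coord_near_def using W p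
      by (intro exI[of _ ?W] exI[of _ ?e] exI[of _ ?e']) simp
    let ?f = "vector [- \<alpha>, 0] :: real ^ 2" and ?f' = "vector [0, 1] :: real ^ 2"
    have "\<forall>q\<in>?W. eigen_line (kerr_J M \<alpha> 1) (kerr_J M \<alpha> (- 1)) tphi_action (- 1) q =
        span {(sin (q $ 2))\<^sup>2 *\<^sub>R ?f + ?f'}"
    proof
      fix q assume "q \<in> ?W"
      then show "eigen_line (kerr_J M \<alpha> 1) (kerr_J M \<alpha> (- 1)) tphi_action (- 1) q =
        span {(sin (q $ 2))\<^sup>2 *\<^sub>R ?f + ?f'}"
        by (auto simp: eigen_line_kerr span_line algebra_simps eq_neg_iff_add_eq_0)
    qed
    moreover have "independent {?f, ?f'}" "?f \<noteq> ?f'"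
      using \<alpha> by (auto intro!: independent_pair)
    moreover have "smooth_on ?W (\<lambda>q. (sin (q $ 2))\<^sup>2)"
      by (intro smooth_intros W)
    ultimately show "affine_coord_near p (eigen_line (kerr_J M \<alpha> 1) (kerr_J M \<alpha> (- 1)) tphi_action (- 1))
        (\<lambda>q. (sin (q $ 2))\<^sup>2)"
      unfolding affine_coord_near_def using W p
      by (intro exI[of _ ?W] exI[of _ ?f] exI[of _ ?f']) simp
    have x: "grad2 (\<lambda>q. (q $ 1)\<^sup>2 - \<alpha>\<^sup>2) p (2 * p $ 1) 0"
      and y: "grad2 (\<lambda>q. (sin (q $ 2))\<^sup>2) p 0 (2 * sin (p $ 2) * cos (p $ 2))"
      by (rule grad2_cong, (rule grad2_intros)+, simp_all)+
    have "p $ 1 \<noteq> 0" "sin (p $ 2) \<noteq> 0"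
      using p kerr_region_nonzero(3)[of p M \<alpha>] by (auto simp: kerr_region_def kerr_Delta_def)
    moreover have "cos (p $ 2) \<noteq> 0"
    proof
      assume "cos (p $ 2) = 0"
      moreover have "0 \<le> p $ 2" "p $ 2 \<le> pi" using p by (auto simp: kerr_region_def)
      ultimately have "p $ 2 = pi / 2"
        using cos_inj_pi[of "p $ 2" "pi / 2"] by simp
      then show False using p H by blast
    qed
    ultimately show "frechet_derivative (\<lambda>q. (q $ 1)\<^sup>2 - \<alpha>\<^sup>2) (at p) (axis 1 1) *
        frechet_derivative (\<lambda>q. (sin (q $ 2))\<^sup>2) (at p) (axis 2 1)
        - frechet_derivative (\<lambda>q. (q $ 1)\<^sup>2 - \<alpha>\<^sup>2) (at p) (axis 2 1) *
        frechet_derivative (\<lambda>q. (sin (q $ 2))\<^sup>2) (at p) (axis 1 1) \<noteq> 0"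
      by (simp add: grad2_frechet[OF x] grad2_frechet[OF y] axis_def)
  qed
  moreover have "inj (\<lambda>a. generator tphi_action a p)" for p
    using inj_tphi_shift by (simp add: generator_tphi)
  ultimately show ?thesis
    unfolding regular_ambitoric_def using W by (intro exI[of _ ?W]) auto
qed

section \<open>Ambitoric coordinates\<close>

definition ambitoric_coords :: "real \<Rightarrow> pt \<Rightarrow> pt" where
  "ambitoric_coords \<alpha> p = vector [p $ 1, \<alpha> * cos (p $ 2), p $ 3 + \<alpha> * p $ 4, - p $ 4 / \<alpha>]"

definition ambitoric_coords_inv :: "real \<Rightarrow> pt \<Rightarrow> pt" where
  "ambitoric_coords_inv \<alpha> q = vector [q $ 1, arccos (q $ 2 / \<alpha>), q $ 3 + \<alpha>\<^sup>2 * q $ 4, - \<alpha> * q $ 4]"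

definition ambitoric_coords_deriv :: "real \<Rightarrow> pt \<Rightarrow> pt \<Rightarrow> pt" where
  "ambitoric_coords_deriv \<alpha> p v =
     vector [v $ 1, - \<alpha> * sin (p $ 2) * v $ 2, v $ 3 + \<alpha> * v $ 4, - v $ 4 / \<alpha>]"

lemma frechet_ambitoric_coords:
  "frechet_derivative (ambitoric_coords \<alpha>) (at p) = ambitoric_coords_deriv \<alpha> p"
proof -
  have "(ambitoric_coords \<alpha> has_derivative ambitoric_coords_deriv \<alpha> p) (at p)"
  proof (rule has_derivative_vecI)
    fix i
    have "\<forall>i. ((\<lambda>q. ambitoric_coords \<alpha> q $ i) has_derivative (\<lambda>u. ambitoric_coords_deriv \<alpha> p u $ i)) (at p)"
      unfolding forall_4 ambitoric_coords_def ambitoric_coords_deriv_def vector_4 divide_inverse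
      by (auto intro!: derivative_eq_intros has_derivative_vec_nth)
    then show "((\<lambda>q. ambitoric_coords \<alpha> q $ i) has_derivative (\<lambda>u. ambitoric_coords_deriv \<alpha> p u $ i)) (at p)"
      by blast
  qed
  then show ?thesis by (rule frechet_derivative_at[symmetric])
qed

text \<open>
  The image of the Kerr region is cut out by A(x) > 0, x^2 > y^2 and B(y) > 0; the last condition
  makes the arc cosine smooth there.
\<close>

lemma ambitoric_coords_image:
  fixes M \<alpha> :: real
  assumes \<alpha>: "\<alpha> \<noteq> 0"
  defines "V \<equiv> {q. (q $ 1)\<^sup>2 - 2 * M * q $ 1 - \<alpha>\<^sup>2 > 0 \<and> (q $ 1)\<^sup>2 > (q $ 2)\<^sup>2 \<and> \<bar>q $ 2 / \<alpha>\<bar> < 1}"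
  shows "p \<in> kerr_region M \<alpha> \<Longrightarrow> ambitoric_coords \<alpha> p \<in> V \<and> ambitoric_coords_inv \<alpha> (ambitoric_coords \<alpha> p) = p"
    and "q \<in> V \<Longrightarrow> ambitoric_coords_inv \<alpha> q \<in> kerr_region M \<alpha> \<and> ambitoric_coords \<alpha> (ambitoric_coords_inv \<alpha> q) = q"
proof -
  assume p: "p \<in> kerr_region M \<alpha>"
  have "sin (p $ 2) \<noteq> 0" using kerr_region_nonzero[OF p] by simp
  then have "(cos (p $ 2))\<^sup>2 < 1" by (simp add: cos_squared_eq)
  then have "\<bar>cos (p $ 2)\<bar> < 1" by (simp add: abs_square_less_1)
  then show "ambitoric_coords \<alpha> p \<in> V \<and> ambitoric_coords_inv \<alpha> (ambitoric_coords \<alpha> p) = p"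
    using p \<alpha> mult_strict_left_mono[of "\<bar>cos (p $ 2)\<bar>" 1 "\<bar>\<alpha>\<bar>"]
    by (auto simp: V_def ambitoric_coords_def ambitoric_coords_inv_def kerr_region_def kerr_Delta_def
        kerr_Sigma_def vec_eq_iff forall_4 arccos_cos power2_eq_square abs_mult mult_ac)
next
  assume q: "q \<in> V"
  then have "\<bar>q $ 2 / \<alpha>\<bar> < 1" unfolding V_def by blast
  then have b: "- 1 < q $ 2 / \<alpha>" "q $ 2 / \<alpha> < 1" by linarith+
  then have "cos (arccos (q $ 2 / \<alpha>)) = q $ 2 / \<alpha>" by (simp add: cos_arccos)
  then show "ambitoric_coords_inv \<alpha> q \<in> kerr_region M \<alpha> \<and> ambitoric_coords \<alpha> (ambitoric_coords_inv \<alpha> q) = q"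
    using q \<alpha> arccos_lt_bounded[OF b]
    by (auto simp: V_def ambitoric_coords_def ambitoric_coords_inv_def kerr_region_def
        kerr_Delta_def kerr_Sigma_def vec_eq_iff forall_4 power_divide power2_eq_square)
qed

lemma coordinates_on_ambitoric_coords:
  assumes \<alpha>: "\<alpha> \<noteq> 0"
  shows "coordinates_on (kerr_region M \<alpha>) (ambitoric_coords \<alpha>)"
proof -
  let ?U = "kerr_region M \<alpha>" and ?\<Phi> = "ambitoric_coords \<alpha>" and ?\<Psi> = "ambitoric_coords_inv \<alpha>"
  let ?V = "{q :: pt. (q $ 1)\<^sup>2 - 2 * M * q $ 1 - \<alpha>\<^sup>2 > 0 \<and> (q $ 1)\<^sup>2 > (q $ 2)\<^sup>2 \<and> \<bar>q $ 2 / \<alpha>\<bar> < 1}"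
  note im = ambitoric_coords_image[OF \<alpha>, where M = M]
  have V: "?\<Phi> ` ?U = ?V"
  proof (intro equalityI subsetI)
    fix q assume "q \<in> ?V"
    from im(2)[OF this] show "q \<in> ?\<Phi> ` ?U" by (intro image_eqI[of q ?\<Phi> "?\<Psi> q"]) simp_all
  qed (use im(1) in blast)
  have inj: "inj_on ?\<Phi> ?U"
    using im(1) by (intro inj_on_inverseI[of _ ?\<Psi>]) blast
  have "open ?V"
    by (intro open_Collect_conj open_Collect_less continuous_intros ballI \<alpha>)
  moreover have "smooth_on ?U ?\<Phi>"
  proof (rule smooth_on_vecI[OF open_kerr_region])
    fix i
    have "\<forall>i. smooth_on ?U (\<lambda>p. ?\<Phi> p $ i)"
      unfolding forall_4 ambitoric_coords_def vector_4
      by (intro conjI smooth_intros open_kerr_region \<alpha>)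
    then show "smooth_on ?U (\<lambda>p. ?\<Phi> p $ i)" by blast
  qed
  moreover have "smooth_on ?V (inv_into ?U ?\<Phi>)"
  proof (rule smooth_on_cong[OF \<open>open ?V\<close>])
    show "smooth_on ?V ?\<Psi>"
    proof (rule smooth_on_vecI[OF \<open>open ?V\<close>])
      fix i
      have "\<forall>i. smooth_on ?V (\<lambda>q. ?\<Psi> q $ i)"
        unfolding forall_4 ambitoric_coords_inv_def vector_4
        by (intro conjI smooth_intros \<open>open ?V\<close> \<alpha>) auto
      then show "smooth_on ?V (\<lambda>q. ?\<Psi> q $ i)" by blast
    qed
    show "?\<Psi> q = inv_into ?U ?\<Phi> q" if "q \<in> ?V" for q
      using im(2)[OF that] inv_into_f_f[OF inj, of "?\<Psi> q"] by simp
  qed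
  ultimately show ?thesis
    using inj by (simp add: coordinates_on_def V)
qed

text \<open>
  Solving t1 = t + \<alpha> \<phi>, t2 = - \<phi> / \<alpha> gives t = t1 + \<alpha>^2 t2 and \<phi> = - \<alpha> t2.
\<close>

lemma coord_fields_ambitoric:
  assumes \<alpha>: "\<alpha> \<noteq> 0" and p: "p \<in> kerr_region M \<alpha>"
  shows "coord_field (ambitoric_coords \<alpha>) 3 p = axis 3 1"
    and "coord_field (ambitoric_coords \<alpha>) 4 p = \<alpha>\<^sup>2 *\<^sub>R axis 3 1 - \<alpha> *\<^sub>R axis 4 1"
proof -
  have "inj (ambitoric_coords_deriv \<alpha> p)"
    using \<alpha> kerr_region_nonzero[OF p]
    by (intro injI) (auto simp: ambitoric_coords_deriv_def vec_eq_iff forall_4)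
  note inv = inv_f_eq[OF this]
  show "coord_field (ambitoric_coords \<alpha>) 3 p = axis 3 1"
    unfolding coord_field_def frechet_ambitoric_coords
    by (rule inv) (simp add: ambitoric_coords_deriv_def vec_eq_iff forall_4 axis_def)
  show "coord_field (ambitoric_coords \<alpha>) 4 p = \<alpha>\<^sup>2 *\<^sub>R axis 3 1 - \<alpha> *\<^sub>R axis 4 1"
    unfolding coord_field_def frechet_ambitoric_coords
    by (rule inv) (use \<alpha> in \<open>simp add: ambitoric_coords_deriv_def vec_eq_iff forall_4 axis_def power2_eq_square\<close>)
qed

lemma torus_fields_tphi:
  "torus_fields U tphi_action = field_span U time_translation axial_rotation"
proof -
  have eq: "generator tphi_action a = (\<lambda>p. a $ 1 *\<^sub>R time_translation p + a $ 2 *\<^sub>R axial_rotation p)" for a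
    by (simp add: fun_eq_iff generator_tphi tphi_shift_def time_translation_def axial_rotation_def)
  show ?thesis
  proof (intro equalityI subsetI)
    fix X assume "X \<in> torus_fields U tphi_action"
    then show "X \<in> field_span U time_translation axial_rotation"
      unfolding torus_fields_def field_span_def eq by blast
  next
    fix X assume "X \<in> field_span U time_translation axial_rotation"
    then obtain c d where X: "X = restrict (\<lambda>p. c *\<^sub>R time_translation p + d *\<^sub>R axial_rotation p) U"
      unfolding field_span_def by blast
    have "X = restrict (generator tphi_action (vector [c, d])) U"
      unfolding X eq by simp
    then show "X \<in> torus_fields U tphi_action"
      unfolding torus_fields_def by blast
  qed
qed

lemma field_span_ambitoric_coords:
  assumes \<alpha>: "\<alpha> \<noteq> 0"
  shows "field_span (kerr_region M \<alpha>) (coord_field (ambitoric_coords \<alpha>) 3) (coord_field (ambitoric_coords \<alpha>) 4)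
     = field_span (kerr_region M \<alpha>) time_translation axial_rotation"
proof -
  let ?U = "kerr_region M \<alpha>" and ?X = "coord_field (ambitoric_coords \<alpha>)"
  have eq: "restrict (\<lambda>p. c *\<^sub>R ?X 3 p + d *\<^sub>R ?X 4 p) ?U
     = restrict (\<lambda>p. (c + d * \<alpha>\<^sup>2) *\<^sub>R time_translation p + (- (d * \<alpha>)) *\<^sub>R axial_rotation p) ?U" for c d
    by (intro restrict_ext)
      (simp add: coord_fields_ambitoric[OF \<alpha>] time_translation_def axial_rotation_def algebra_simps)
  show ?thesis
  proof (intro equalityI subsetI)
    fix X assume "X \<in> field_span ?U (?X 3) (?X 4)"
    then show "X \<in> field_span ?U time_translation axial_rotation"
      unfolding field_span_def eq by blast
  next
    fix X assume "X \<in> field_span ?U time_translation axial_rotation"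
    then obtain c d where X: "X = restrict (\<lambda>p. c *\<^sub>R time_translation p + d *\<^sub>R axial_rotation p) ?U"
      unfolding field_span_def by blast
    have "X = restrict (\<lambda>p. (c + d * \<alpha>) *\<^sub>R ?X 3 p + (- d / \<alpha>) *\<^sub>R ?X 4 p) ?U"
      unfolding X eq using \<alpha> by (simp add: power2_eq_square)
    then show "X \<in> field_span ?U (?X 3) (?X 4)"
      unfolding field_span_def by blast
  qed
qed

text \<open>
  The identities \<open>\<sigma>\<close>, \<open>\<tau>\<close>, \<open>S\<close>, \<open>A\<close>, \<open>B\<close> of the proof translate each ingredient of the hyperbolic
  forms; the factors of \<alpha> cancel between \<tau> and \<open>B\<close>, and between \<tau> and dy.
\<close>

lemma pullback_hyperbolic:
  assumes \<alpha>: "\<alpha> \<noteq> 0" and p: "p \<in> kerr_region M \<alpha>"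
  shows "pullback (ambitoric_coords \<alpha>) (hyperbolic_metric (\<lambda>x. x\<^sup>2 - 2 * M * x - \<alpha>\<^sup>2) (\<lambda>y. \<alpha>\<^sup>2 - y\<^sup>2)) p v w
     = kerr_metric M \<alpha> p v w / kerr_Sigma \<alpha> p"
    and "pullback (ambitoric_coords \<alpha>) (hyperbolic_form \<epsilon>) p v w = kerr_kahler_form \<alpha> \<epsilon> p v w"
proof -
  let ?r = "p $ 1" and ?s = "sin (p $ 2)" and ?c = "cos (p $ 2)"
  have \<sigma>: "u $ 3 + \<alpha> * u $ 4 + (\<alpha> * ?c)\<^sup>2 * (- u $ 4 / \<alpha>) = u $ 3 + \<alpha> * ?s\<^sup>2 * u $ 4" for u :: pt
    by (simp add: divide_simps \<alpha>) (use kerr_relations(3)[where p = p] in algebra)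
  have \<tau>: "u $ 3 + \<alpha> * u $ 4 + ?r\<^sup>2 * (- u $ 4 / \<alpha>) = - ((?r\<^sup>2 - \<alpha>\<^sup>2) * u $ 4 - \<alpha> * u $ 3) / \<alpha>" for u :: pt
    using \<alpha> by (simp add: field_simps power2_eq_square)
  have S: "?r\<^sup>2 - (\<alpha> * ?c)\<^sup>2 = kerr_Sigma \<alpha> p" and B: "\<alpha>\<^sup>2 - (\<alpha> * ?c)\<^sup>2 = \<alpha>\<^sup>2 * ?s\<^sup>2"
    and A: "?r\<^sup>2 - 2 * M * ?r - \<alpha>\<^sup>2 = kerr_Delta M \<alpha> p"
    by (simp_all add: kerr_Sigma_def kerr_Delta_def sin_squared_eq power_mult_distrib algebra_simps)
  show "pullback (ambitoric_coords \<alpha>) (hyperbolic_metric (\<lambda>x. x\<^sup>2 - 2 * M * x - \<alpha>\<^sup>2) (\<lambda>y. \<alpha>\<^sup>2 - y\<^sup>2)) p v w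
     = kerr_metric M \<alpha> p v w / kerr_Sigma \<alpha> p"
    using \<alpha> kerr_region_nonzero[OF p]
    unfolding pullback_def frechet_ambitoric_coords hyperbolic_metric_def Let_def
      ambitoric_coords_def ambitoric_coords_deriv_def vector_4 \<sigma> \<tau> S A B kerr_metric_def
    by (simp add: field_simps power2_eq_square)
  show "pullback (ambitoric_coords \<alpha>) (hyperbolic_form \<epsilon>) p v w = kerr_kahler_form \<alpha> \<epsilon> p v w"
    using \<alpha>
    unfolding pullback_def frechet_ambitoric_coords hyperbolic_form_def Let_def wedge_def
      ambitoric_coords_def ambitoric_coords_deriv_def vector_4 \<sigma> \<tau> kerr_kahler_form_def kahler_scale_def
    by (simp add: add_divide_distrib diff_divide_distrib right_diff_distrib mult_ac)
qed

section \<open>The ambitoric structure of the Kerr metric\<close>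

theorem mainTheorem5:
  fixes M \<alpha> :: real and \<Lambda> :: "(real ^ 2) set"
    and U \<Gamma> :: "pt set" and g :: tensor2 and A B :: "real \<Rightarrow> real"
  assumes "\<alpha> \<noteq> 0"
    and "full_lattice \<Lambda>"
  defines "U \<equiv> kerr_region M \<alpha>"
    and "\<Gamma> \<equiv> tphi_shift ` \<Lambda>"
    and "g \<equiv> kerr_metric M \<alpha>"
    and "A \<equiv> (\<lambda>x. x\<^sup>2 - 2 * M * x - \<alpha>\<^sup>2)"
    and "B \<equiv> (\<lambda>y. \<alpha>\<^sup>2 - y\<^sup>2)"
  shows "\<exists>Jp Jm gp gm f g0 \<Phi>.
    ambitoric U \<Gamma> (conformal_class U \<Gamma> g) Jp Jm gp gm \<Lambda> tphi_action \<and>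
    regular_ambitoric U Jp Jm tphi_action \<and>
    barycentric U gp gm f g0 \<and>
    torus_fields U tphi_action = field_span U time_translation axial_rotation \<and>
    coordinates_on U \<Phi> \<and>
    torus_fields U tphi_action = field_span U (coord_field \<Phi> 3) (coord_field \<Phi> 4) \<and>
    (\<forall>p\<in>U. let x = \<Phi> p $ 1; y = \<Phi> p $ 2 in
       x + y \<noteq> 0 \<and> x - y \<noteq> 0 \<and> A x > 0 \<and> B y > 0 \<and> f p = (x + y) / (x - y) \<and>
       (\<forall>v w.
          g0 p v w = pullback \<Phi> (hyperbolic_metric A B) p v w \<and>
          fundamental_form gp Jp p v w = pullback \<Phi> (hyperbolic_form 1) p v w \<and>
          fundamental_form gm Jm p v w = pullback \<Phi> (hyperbolic_form (- 1)) p v w \<and>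
          g p v w = (x\<^sup>2 - y\<^sup>2) * g0 p v w)) \<and>
    riemannian_metric U \<Gamma> g \<and> ricci_flat U g"
proof -
  have scale: "\<Phi> $ 1 + \<Phi> $ 2 = kahler_scale \<alpha> 1 p" "\<Phi> $ 1 - \<Phi> $ 2 = kahler_scale \<alpha> (- 1) p"
    "A (\<Phi> $ 1) = kerr_Delta M \<alpha> p" "B (\<Phi> $ 2) = \<alpha>\<^sup>2 * (sin (p $ 2))\<^sup>2"
    "(\<Phi> $ 1)\<^sup>2 - (\<Phi> $ 2)\<^sup>2 = kerr_Sigma \<alpha> p"
    if "\<Phi> = ambitoric_coords \<alpha> p" for \<Phi> p
    by (simp_all add: that ambitoric_coords_def kahler_scale_def A_def B_def kerr_Delta_def kerr_Sigma_def
        sin_squared_eq power_mult_distrib algebra_simps)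
  show ?thesis
  proof (intro exI conjI)
    show "ambitoric U \<Gamma> (conformal_class U \<Gamma> g) (kerr_J M \<alpha> 1) (kerr_J M \<alpha> (- 1))
        (kerr_kahler_metric M \<alpha> 1) (kerr_kahler_metric M \<alpha> (- 1)) \<Lambda> tphi_action"
      unfolding U_def \<Gamma>_def g_def by (rule ambitoric_kerr[OF assms(2)])
    show "regular_ambitoric U (kerr_J M \<alpha> 1) (kerr_J M \<alpha> (- 1)) tphi_action"
      unfolding U_def by (rule regular_ambitoric_kerr[OF assms(1)])
    show "barycentric U (kerr_kahler_metric M \<alpha> 1) (kerr_kahler_metric M \<alpha> (- 1))
        (\<lambda>p. kahler_scale \<alpha> 1 p / kahler_scale \<alpha> (- 1) p) (\<lambda>p v w. g p v w / kerr_Sigma \<alpha> p)"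
      unfolding U_def g_def by (rule barycentric_kerr)
    show "torus_fields U tphi_action = field_span U time_translation axial_rotation"
      by (rule torus_fields_tphi)
    show "coordinates_on U (ambitoric_coords \<alpha>)"
      unfolding U_def by (rule coordinates_on_ambitoric_coords[OF assms(1)])
    show "torus_fields U tphi_action
        = field_span U (coord_field (ambitoric_coords \<alpha>) 3) (coord_field (ambitoric_coords \<alpha>) 4)"
      unfolding U_def torus_fields_tphi field_span_ambitoric_coords[OF assms(1)] ..
    show "riemannian_metric U \<Gamma> g"
      unfolding U_def \<Gamma>_def g_def by (rule riemannian_metric_kerr)
    show "ricci_flat U g"
      unfolding U_def g_def by (rule ricci_flat_kerr)
  next
    show "\<forall>p\<in>U. let x = ambitoric_coords \<alpha> p $ 1; y = ambitoric_coords \<alpha> p $ 2 in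
       x + y \<noteq> 0 \<and> x - y \<noteq> 0 \<and> A x > 0 \<and> B y > 0 \<and>
       kahler_scale \<alpha> 1 p / kahler_scale \<alpha> (- 1) p = (x + y) / (x - y) \<and>
       (\<forall>v w.
          g p v w / kerr_Sigma \<alpha> p = pullback (ambitoric_coords \<alpha>) (hyperbolic_metric A B) p v w \<and>
          fundamental_form (kerr_kahler_metric M \<alpha> 1) (kerr_J M \<alpha> 1) p v w
            = pullback (ambitoric_coords \<alpha>) (hyperbolic_form 1) p v w \<and>
          fundamental_form (kerr_kahler_metric M \<alpha> (- 1)) (kerr_J M \<alpha> (- 1)) p v w
            = pullback (ambitoric_coords \<alpha>) (hyperbolic_form (- 1)) p v w \<and>
          g p v w = (x\<^sup>2 - y\<^sup>2) * (g p v w / kerr_Sigma \<alpha> p))"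
    proof
      fix p assume "p \<in> U"
      then have p: "p \<in> kerr_region M \<alpha>" by (simp add: U_def)
      have "kerr_Delta M \<alpha> p > 0" using p by (simp add: kerr_region_def)
      then show "let x = ambitoric_coords \<alpha> p $ 1; y = ambitoric_coords \<alpha> p $ 2 in
       x + y \<noteq> 0 \<and> x - y \<noteq> 0 \<and> A x > 0 \<and> B y > 0 \<and>
       kahler_scale \<alpha> 1 p / kahler_scale \<alpha> (- 1) p = (x + y) / (x - y) \<and>
       (\<forall>v w.
          g p v w / kerr_Sigma \<alpha> p = pullback (ambitoric_coords \<alpha>) (hyperbolic_metric A B) p v w \<and>
          fundamental_form (kerr_kahler_metric M \<alpha> 1) (kerr_J M \<alpha> 1) p v w
            = pullback (ambitoric_coords \<alpha>) (hyperbolic_form 1) p v w \<and>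
          fundamental_form (kerr_kahler_metric M \<alpha> (- 1)) (kerr_J M \<alpha> (- 1)) p v w
            = pullback (ambitoric_coords \<alpha>) (hyperbolic_form (- 1)) p v w \<and>
          g p v w = (x\<^sup>2 - y\<^sup>2) * (g p v w / kerr_Sigma \<alpha> p))"
        unfolding Let_def scale[OF refl]
        using assms(1) kerr_region_nonzero[OF p] kahler_scale_nonzero[OF p]
        by (simp add: pullback_hyperbolic[OF assms(1) p, folded A_def B_def]
            fundamental_form_kerr[OF p] g_def)
    qed
  qed
qed

end
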